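(* Let $\mathcal H$ be a Hilbert space, let $H_0$ be a self-adjoint operator in $\mathcal H$ with domain $\mathcal D$, bounded below, and let $H_1$ be a bounded (continuous) operator on $\mathcal H$, $H_1\neq 0$. Assume there is a unitary involution $J$ on $\mathcal H$ with $J\mathcal D\subset\mathcal D$, $JH_0=H_0J$ and $JH_1=H_1^*J$. Suppose $H_0$ has discrete spectrum $\sigma(H_0)=\{\lambda_0<\lambda_1<\dots<\lambda_l<\dots\}$, all eigenvalues simple, with $$\delta:=\inf_{j\ge0}\,\frac{\lambda_{j+1}-\lambda_j}{2}>0.$$ For $\epsilon\in\mathbb C$ let $H_\epsilon=H_0+\epsilon H_1$ with domain $\mathcal D$. Then $\sigma(H_\epsilon)\subset\mathbb R$ for every real $\epsilon$ with $|\epsilon|<\delta/\|H_1\|$.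
   Context: $H_1^*$ denotes the adjoint of $H_1$. The intertwining relations imply $JH_\epsilon=H_\epsilon^*J$ for real $\epsilon$. *)

theory Defs
  imports "HOL-Analysis.Analysis"
begin

text \<open>A complex Hilbert space is modelled on a type 'h carrying an additive group
structure, together with an explicit complex scalar multiplication sc and an
inner product ip (linear in the first, conjugate-linear in the second argument).\<close>

definition hnorm :: "('h \<Rightarrow> 'h \<Rightarrow> complex) \<Rightarrow> 'h \<Rightarrow> real" where
  "hnorm ip x = sqrt (Re (ip x x))"

definition chilbert :: "(complex \<Rightarrow> 'h::ab_group_add \<Rightarrow> 'h) \<Rightarrow> ('h \<Rightarrow> 'h \<Rightarrow> complex) \<Rightarrow> bool" where
  "chilbert sc ip \<longleftrightarrow>
     (\<forall>a x y. sc a (x + y) = sc a x + sc a y) \<and>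
     (\<forall>a b x. sc (a + b) x = sc a x + sc b x) \<and>
     (\<forall>a b x. sc a (sc b x) = sc (a * b) x) \<and>
     (\<forall>x. sc 1 x = x) \<and>
     (\<forall>x y z. ip (x + y) z = ip x z + ip y z) \<and>
     (\<forall>a x y. ip (sc a x) y = a * ip x y) \<and>
     (\<forall>x y. ip y x = cnj (ip x y)) \<and>
     (\<forall>x. x \<noteq> 0 \<longrightarrow> Re (ip x x) > 0) \<and>
     (\<forall>X :: nat \<Rightarrow> 'h.
        (\<forall>e>0. \<exists>N. \<forall>m\<ge>N. \<forall>n\<ge>N. hnorm ip (X m - X n) < e) \<longrightarrow>
        (\<exists>L. \<forall>e>0. \<exists>N. \<forall>n\<ge>N. hnorm ip (X n - L) < e))"

definition subspace_h :: "(complex \<Rightarrow> 'h::ab_group_add \<Rightarrow> 'h) \<Rightarrow> 'h set \<Rightarrow> bool" where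
  "subspace_h sc D \<longleftrightarrow> 0 \<in> D \<and> (\<forall>x\<in>D. \<forall>y\<in>D. x + y \<in> D) \<and> (\<forall>a. \<forall>x\<in>D. sc a x \<in> D)"

definition dense_h :: "('h::ab_group_add \<Rightarrow> 'h \<Rightarrow> complex) \<Rightarrow> 'h set \<Rightarrow> bool" where
  "dense_h ip D \<longleftrightarrow> (\<forall>x. \<forall>e>0. \<exists>y\<in>D. hnorm ip (x - y) < e)"

definition linear_on_h :: "(complex \<Rightarrow> 'h::ab_group_add \<Rightarrow> 'h) \<Rightarrow> 'h set \<Rightarrow> ('h \<Rightarrow> 'h) \<Rightarrow> bool" where
  "linear_on_h sc D T \<longleftrightarrow> subspace_h sc D \<and>
     (\<forall>x\<in>D. \<forall>y\<in>D. T (x + y) = T x + T y) \<and> (\<forall>a. \<forall>x\<in>D. T (sc a x) = sc a (T x))"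

definition bounded_op :: "(complex \<Rightarrow> 'h::ab_group_add \<Rightarrow> 'h) \<Rightarrow> ('h \<Rightarrow> 'h \<Rightarrow> complex) \<Rightarrow> ('h \<Rightarrow> 'h) \<Rightarrow> bool" where
  "bounded_op sc ip T \<longleftrightarrow> linear_on_h sc UNIV T \<and> (\<exists>C. \<forall>x. hnorm ip (T x) \<le> C * hnorm ip x)"

definition opnorm :: "('h::ab_group_add \<Rightarrow> 'h \<Rightarrow> complex) \<Rightarrow> ('h \<Rightarrow> 'h) \<Rightarrow> real" where
  "opnorm ip T = (SUP x\<in>{x. hnorm ip x \<le> 1}. hnorm ip (T x))"

definition adjoint_op :: "('h \<Rightarrow> 'h \<Rightarrow> complex) \<Rightarrow> ('h \<Rightarrow> 'h) \<Rightarrow> ('h \<Rightarrow> 'h)" where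
  "adjoint_op ip T = (\<lambda>y. THE z. \<forall>x. ip (T x) y = ip x z)"

text \<open>Self-adjoint (possibly unbounded) operator T with domain D: densely defined,
linear, symmetric, and the domain of the adjoint is contained in D
(so T = T*).\<close>
definition self_adjoint_on :: "(complex \<Rightarrow> 'h::ab_group_add \<Rightarrow> 'h) \<Rightarrow> ('h \<Rightarrow> 'h \<Rightarrow> complex) \<Rightarrow> 'h set \<Rightarrow> ('h \<Rightarrow> 'h) \<Rightarrow> bool" where
  "self_adjoint_on sc ip D T \<longleftrightarrow> dense_h ip D \<and> linear_on_h sc D T \<and>
     (\<forall>x\<in>D. \<forall>y\<in>D. ip (T x) y = ip x (T y)) \<and>
     (\<forall>y z. (\<forall>x\<in>D. ip (T x) y = ip x z) \<longrightarrow> y \<in> D)"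

definition bounded_below_on :: "('h::ab_group_add \<Rightarrow> 'h \<Rightarrow> complex) \<Rightarrow> 'h set \<Rightarrow> ('h \<Rightarrow> 'h) \<Rightarrow> bool" where
  "bounded_below_on ip D T \<longleftrightarrow> (\<exists>c::real. \<forall>x\<in>D. c * (hnorm ip x)\<^sup>2 \<le> Re (ip (T x) x))"

definition resolvent_set :: "(complex \<Rightarrow> 'h::ab_group_add \<Rightarrow> 'h) \<Rightarrow> ('h \<Rightarrow> 'h \<Rightarrow> complex) \<Rightarrow> 'h set \<Rightarrow> ('h \<Rightarrow> 'h) \<Rightarrow> complex set" where
  "resolvent_set sc ip D T = {z. bij_betw (\<lambda>x. T x - sc z x) D UNIV \<and>
      (\<exists>C. \<forall>x\<in>D. hnorm ip x \<le> C * hnorm ip (T x - sc z x))}"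

definition spectrum_op :: "(complex \<Rightarrow> 'h::ab_group_add \<Rightarrow> 'h) \<Rightarrow> ('h \<Rightarrow> 'h \<Rightarrow> complex) \<Rightarrow> 'h set \<Rightarrow> ('h \<Rightarrow> 'h) \<Rightarrow> complex set" where
  "spectrum_op sc ip D T = - resolvent_set sc ip D T"

definition eigenspace_op :: "(complex \<Rightarrow> 'h::ab_group_add \<Rightarrow> 'h) \<Rightarrow> 'h set \<Rightarrow> ('h \<Rightarrow> 'h) \<Rightarrow> complex \<Rightarrow> 'h set" where
  "eigenspace_op sc D T z = {x\<in>D. T x = sc z x}"

definition simple_eigenvalue :: "(complex \<Rightarrow> 'h::ab_group_add \<Rightarrow> 'h) \<Rightarrow> 'h set \<Rightarrow> ('h \<Rightarrow> 'h) \<Rightarrow> complex \<Rightarrow> bool" where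
  "simple_eigenvalue sc D T z \<longleftrightarrow> (\<exists>v. v \<noteq> 0 \<and> eigenspace_op sc D T z = range (\<lambda>a. sc a v))"

end

theory Submission
  imports Defs
begin

text \<open>Put B = \<epsilon> H1, b = norm of B, and let z be nonreal. Choose the eigenvalue l of H0
  nearest to Re z, with eigenvector e, and split u = a e + q with q orthogonal to e. If d bounds from
  below the distance of Re z to all the other eigenvalues, then
  norm ((H0 - z) u)^2 \<ge> (l - Re z)^2 norm (a e)^2 + d^2 norm q^2, and the gap condition allows
  (l - Re z)^2 + d^2 \<ge> 2 \<delta>^2 > 2 b^2 with d \<ge> \<bar>l - Re z\<bar>. If H u = z u, then ip (J u) u = 0, and as
  J e = \<plusminus> e this forces norm (a e) \<le> norm q. Together with norm ((H0 - z) u) = norm (B u)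
  \<le> b norm u this gives u = 0. The same estimates with an error term bound H - z from below, and
  since J (H - cnj z) J is the adjoint of H - z, its range is everything.

  The bound on the complement of e is proved without the spectral theorem. If H0 - c were bounded
  below by an optimal m < r, where the interval of radius r around c lies in the resolvent set, then
  (H0 - c - m) (H0 - c + m) = (H0 - c)^2 - m^2 would be bounded below, which contradicts optimality. The case
  where the interval contains the simple eigenvalue l is reduced to the two gaps next to l.\<close>

section \<open>Geometry of the inner product: norm, Cauchy-Schwarz, parallelogram law\<close>

locale complex_hilbert =
  fixes sc :: "complex \<Rightarrow> 'h::ab_group_add \<Rightarrow> 'h"
    and ip :: "'h \<Rightarrow> 'h \<Rightarrow> complex"
  assumes chilbert: "chilbert sc ip"
begin

sublocale vector_space sc
proof
  note c = chilbert[unfolded chilbert_def]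
  show "sc a (x + y) = sc a x + sc a y" for a x y
    by (rule c[THEN conjunct1, rule_format])
  show "sc (a + b) x = sc a x + sc b x" for a b x
    by (rule c[THEN conjunct2, THEN conjunct1, rule_format])
  show "sc a (sc b x) = sc (a * b) x" for a b x
    by (rule c[THEN conjunct2, THEN conjunct2, THEN conjunct1, rule_format])
  show "sc 1 x = x" for x
    by (rule c[THEN conjunct2, THEN conjunct2, THEN conjunct2, THEN conjunct1, rule_format])
qed

abbreviation nr :: "'h \<Rightarrow> real" where "nr \<equiv> hnorm ip"

lemma ip_add_left: "ip (x + y) z = ip x z + ip y z"
  and ip_scale_left: "ip (sc a x) y = a * ip x y"
  and ip_commute: "ip y x = cnj (ip x y)"
  and ip_pos: "x \<noteq> 0 \<Longrightarrow> Re (ip x x) > 0"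
  using chilbert unfolding chilbert_def by blast+

text \<open>Completeness phrased through a real null sequence of distances, so that limit theorems
  for real sequences apply.\<close>

lemma complete:
  assumes "\<And>e. e > 0 \<Longrightarrow> \<exists>N. \<forall>m\<ge>N. \<forall>n\<ge>N. nr (X m - X n) < e"
  shows "\<exists>L. (\<lambda>n. nr (X n - L)) \<longlonglongrightarrow> 0"
proof -
  have "\<exists>L. \<forall>e>0. \<exists>N. \<forall>n\<ge>N. nr (X n - L) < e"
    using chilbert assms unfolding chilbert_def by blast
  then obtain L where L: "\<And>e. e > 0 \<Longrightarrow> \<exists>N. \<forall>n\<ge>N. nr (X n - L) < e" by blast
  have nn: "nr x \<ge> 0" for x
  proof (cases "x = 0")
    case True
    have "ip (0 + 0) (0::'h) = ip 0 0 + ip 0 0" by (rule ip_add_left)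
    then have "ip 0 (0::'h) = 0" by simp
    then show ?thesis by (simp add: hnorm_def True)
  qed (use ip_pos[of x] in \<open>simp add: hnorm_def\<close>)
  show ?thesis
    by (rule exI[of _ L]) (use L nn in \<open>auto simp: LIMSEQ_iff\<close>)
qed

lemma ip_add_right: "ip z (x + y) = ip z x + ip z y"
  by (metis ip_add_left ip_commute complex_cnj_add)

lemma ip_scale_right: "ip x (sc a y) = cnj a * ip x y"
  by (metis ip_scale_left ip_commute complex_cnj_mult)

lemma ip_zero_left [simp]: "ip 0 x = 0"
  using ip_scale_left[of 0 0 x] by simp

lemma ip_zero_right [simp]: "ip x 0 = 0"
  using ip_scale_right[of x 0 0] by simp

lemma ip_minus_left: "ip (- x) y = - ip x y"
  using ip_add_left[of x "- x" y] by (simp add: add_eq_0_iff)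

lemma ip_minus_right: "ip x (- y) = - ip x y"
  using ip_add_right[of x y "- y"] by (simp add: add_eq_0_iff)

lemma ip_diff_left: "ip (x - y) z = ip x z - ip y z"
  using ip_add_left[of x "- y" z] by (simp add: ip_minus_left)

lemma ip_diff_right: "ip z (x - y) = ip z x - ip z y"
  using ip_add_right[of z x "- y"] by (simp add: ip_minus_right)

lemmas ip_linear = ip_add_left ip_add_right ip_scale_left ip_scale_right
  ip_minus_left ip_minus_right ip_diff_left ip_diff_right

lemma ip_self_nonneg: "Re (ip x x) \<ge> 0"
  using ip_pos[of x] by (cases "x = 0") auto

lemma nr_nonneg [simp]: "nr x \<ge> 0"
  by (simp add: hnorm_def ip_self_nonneg)

lemma nr_square: "(nr x)\<^sup>2 = Re (ip x x)"
  by (simp add: hnorm_def ip_self_nonneg)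

lemma ip_self: "ip x x = of_real ((nr x)\<^sup>2)"
  using ip_commute[of x x] by (simp add: nr_square complex_eq_iff)

lemma nr_zero [simp]: "nr 0 = 0"
  by (simp add: hnorm_def)

lemma nr_eq_0_iff [simp]: "nr x = 0 \<longleftrightarrow> x = 0"
  using ip_pos[of x] by (cases "x = 0") (auto simp: hnorm_def)

lemma nr_pos: "x \<noteq> 0 \<Longrightarrow> nr x > 0"
  using nr_nonneg[of x] nr_eq_0_iff[of x] by linarith

lemma nr_scale: "nr (sc a x) = cmod a * nr x"
proof -
  have "(nr (sc a x))\<^sup>2 = Re (a * cnj a * ip x x)"
    unfolding nr_square by (simp only: ip_linear mult_ac)
  also have "\<dots> = (cmod a * nr x)\<^sup>2"
    unfolding ip_self complex_mult_cnj by (simp add: power_mult_distrib cmod_power2)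
  finally show ?thesis by (simp add: power2_eq_iff_nonneg)
qed

lemma nr_minus [simp]: "nr (- x) = nr x"
  by (simp add: hnorm_def ip_linear)

lemma nr_minus_commute: "nr (x - y) = nr (y - x)"
  using nr_minus[of "x - y"] by simp

lemma nr_add_square: "(nr (x + y))\<^sup>2 = (nr x)\<^sup>2 + 2 * Re (ip x y) + (nr y)\<^sup>2"
  using ip_commute[of x y] by (simp add: nr_square ip_linear)

lemma nr_diff_square: "(nr (x - y))\<^sup>2 = (nr x)\<^sup>2 - 2 * Re (ip x y) + (nr y)\<^sup>2"
  using ip_commute[of x y] by (simp add: nr_square ip_linear)

text \<open>Pythagoras for the component of \<open>x\<close> along \<open>y\<close>. Nonnegativity
  of the left side gives Cauchy-Schwarz; the strict drop when \<open>ip x y\<close> is nonzero shows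
  that a shortest difference is orthogonal.\<close>

lemma nr_diff_proj:
  assumes "y \<noteq> 0"
  shows "(nr (x - sc (ip x y / of_real ((nr y)\<^sup>2)) y))\<^sup>2 = (nr x)\<^sup>2 - (cmod (ip x y))\<^sup>2 / (nr y)\<^sup>2"
proof -
  let ?c = "ip x y / of_real ((nr y)\<^sup>2)"
  have "Re (ip x (sc ?c y)) = (cmod (ip x y))\<^sup>2 / (nr y)\<^sup>2"
    unfolding ip_scale_right cmod_power2 by (simp add: power2_eq_square)
  moreover have "(nr (sc ?c y))\<^sup>2 = (cmod (ip x y))\<^sup>2 / (nr y)\<^sup>2"
    using assms by (simp add: nr_scale norm_divide norm_mult power2_eq_square)
  ultimately show ?thesis
    by (simp add: nr_diff_square)
qed

lemma cauchy_schwarz: "cmod (ip x y) \<le> nr x * nr y"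
proof (cases "y = 0")
  case False
  have "(cmod (ip x y))\<^sup>2 / (nr y)\<^sup>2 \<le> (nr x)\<^sup>2"
    using nr_diff_proj[OF False, of x] by (metis diff_ge_0_iff_ge zero_le_power2)
  then have "(cmod (ip x y))\<^sup>2 \<le> (nr x * nr y)\<^sup>2"
    using False by (simp add: pos_divide_le_eq[of "(nr y)\<^sup>2"] power_mult_distrib)
  then show ?thesis
    by (rule power2_le_imp_le) simp
qed simp

lemma nr_triangle: "nr (x + y) \<le> nr x + nr y"
proof -
  have "Re (ip x y) \<le> nr x * nr y"
    using complex_Re_le_cmod cauchy_schwarz order_trans by blast
  then have "(nr (x + y))\<^sup>2 \<le> (nr x + nr y)\<^sup>2"
    by (simp add: nr_add_square power2_sum)
  then show ?thesis
    by (rule power2_le_imp_le) simp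
qed

lemma nr_triangle_diff: "nr (x - y) \<le> nr x + nr y"
  using nr_triangle[of x "- y"] by simp

lemma nr_triangle_sub: "nr x \<le> nr y + nr (x - y)"
  using nr_triangle[of y "x - y"] by simp

lemma parallelogram: "(nr (x + y))\<^sup>2 + (nr (x - y))\<^sup>2 = 2 * (nr x)\<^sup>2 + 2 * (nr y)\<^sup>2"
  by (simp add: nr_add_square nr_diff_square)

section \<open>Orthogonal projection and Riesz representation\<close>

lemma orthogonal_if_nearest:
  assumes "\<And>t. nr u \<le> nr (u - sc t m)"
  shows "ip u m = 0"
proof (cases "m = 0")
  case False
  have "(nr u)\<^sup>2 \<le> (nr u)\<^sup>2 - (cmod (ip u m))\<^sup>2 / (nr m)\<^sup>2"
    using assms by (subst nr_diff_proj[OF False, symmetric]) (simp add: power_mono)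
  then have "(cmod (ip u m))\<^sup>2 \<le> 0"
    using nr_pos[OF False] False by (simp add: divide_le_0_iff)
  then show ?thesis by simp
qed simp

lemma tendsto_ip_right:
  assumes "(\<lambda>n. nr (X n - L)) \<longlonglongrightarrow> 0"
  shows "(\<lambda>n. ip y (X n)) \<longlonglongrightarrow> ip y L"
proof (rule LIM_zero_cancel, rule tendsto_norm_zero_cancel, rule Lim_null_comparison)
  have "norm (norm (ip y (X n) - ip y L)) \<le> nr y * nr (X n - L)" for n
    using cauchy_schwarz[of y "X n - L"] by (simp add: ip_diff_right)
  then show "\<forall>\<^sub>F n in sequentially. norm (norm (ip y (X n) - ip y L)) \<le> nr y * nr (X n - L)"
    by (intro always_eventually) blast
  show "(\<lambda>n. nr y * nr (X n - L)) \<longlonglongrightarrow> 0"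
    using tendsto_mult_right_zero[OF assms] .
qed

text \<open>A minimizing sequence for the distance from \<open>x\<close> to \<open>M\<close> is
  Cauchy. Since \<open>M\<close> may fail to be closed, its limit \<open>p\<close> lies only in the
  closure, so the approximating sequence is returned as well.\<close>

lemma projection_closure:
  assumes M: "subspace_h sc M"
  obtains p X where "\<And>n. X n \<in> M" "(\<lambda>n. nr (X n - p)) \<longlonglongrightarrow> 0"
    and "\<And>m. m \<in> M \<Longrightarrow> ip (x - p) m = 0"
proof -
  have M0: "0 \<in> M" and Madd: "a + b \<in> M" and Msc: "sc t a \<in> M" if "a \<in> M" "b \<in> M" for a b t
    using M that unfolding subspace_h_def by auto
  define d where "d = (INF m\<in>M. nr (x - m))"
  have bdd: "bdd_below ((\<lambda>m. nr (x - m)) ` M)"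
    by (rule bdd_belowI[of _ 0]) auto
  have ne: "M \<noteq> {}" using M unfolding subspace_h_def by auto
  have d_le: "d \<le> nr (x - m)" if "m \<in> M" for m
    unfolding d_def using bdd that by (rule cINF_lower)
  have d0: "d \<ge> 0"
    unfolding d_def by (rule cINF_greatest[OF ne]) simp
  have "\<exists>m\<in>M. nr (x - m) < d + 1 / real (Suc n)" for n
    using cINF_less_iff[OF ne bdd, of "d + 1 / real (Suc n)"] unfolding d_def by simp
  then obtain X where XM: "\<And>n. X n \<in> M" and X: "\<And>n. nr (x - X n) < d + 1 / real (Suc n)"
    by metis
  have lim0: "(\<lambda>n. 1 / real (Suc n)) \<longlonglongrightarrow> 0"
    using LIMSEQ_inverse_real_of_nat by (simp add: inverse_eq_divide)
  have limd: "(\<lambda>n. nr (x - X n)) \<longlonglongrightarrow> d"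
  proof (rule tendsto_sandwich[OF _ _ tendsto_const[of d]])
    show "(\<lambda>n. d + 1 / real (Suc n)) \<longlonglongrightarrow> d"
      using tendsto_add[OF tendsto_const[of d] lim0] by simp
  qed (use d_le XM X in \<open>auto simp: less_imp_le\<close>)
  have sq: "(nr (X m - X n))\<^sup>2 \<le> 2 * (nr (x - X m))\<^sup>2 + 2 * (nr (x - X n))\<^sup>2 - 4 * d\<^sup>2" for m n
  proof -
    \<comment> \<open>The midpoint of \<open>X m\<close> and \<open>X n\<close> lies in
      \<open>M\<close>, so this sum has norm at least \<open>2 * d\<close>; the parallelogram law
      then bounds \<open>nr (X m - X n)\<close>.\<close>
    have eq: "(x - X m) + (x - X n) = sc 2 (x - sc (1/2) (X m + X n))"
      using scale_left_distrib[of 1 1 x] by (simp add: scale_right_diff_distrib)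
    have "4 * d\<^sup>2 \<le> (nr ((x - X m) + (x - X n)))\<^sup>2"
      unfolding eq nr_scale using d_le[OF Msc[OF Madd[OF XM XM] XM], of "1/2" m n] d0
      by (simp add: power_mult_distrib power_mono)
    then show ?thesis
      using parallelogram[of "x - X m" "x - X n"] by (simp add: nr_minus_commute)
  qed
  have "\<exists>N. \<forall>m\<ge>N. \<forall>n\<ge>N. nr (X m - X n) < e" if "e > 0" for e
  proof -
    have "(\<lambda>n. (nr (x - X n))\<^sup>2) \<longlonglongrightarrow> d\<^sup>2"
      by (intro tendsto_intros limd)
    moreover have "d\<^sup>2 < d\<^sup>2 + e\<^sup>2 / 4" using that by simp
    ultimately have "\<forall>\<^sub>F n in sequentially. (nr (x - X n))\<^sup>2 < d\<^sup>2 + e\<^sup>2 / 4"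
      by (rule order_tendstoD)
    then obtain N where N: "\<And>n. n \<ge> N \<Longrightarrow> (nr (x - X n))\<^sup>2 < d\<^sup>2 + e\<^sup>2 / 4"
      by (auto simp: eventually_sequentially)
    have "(nr (X m - X n))\<^sup>2 < e\<^sup>2" if "m \<ge> N" "n \<ge> N" for m n
      using sq[of m n] N[OF that(1)] N[OF that(2)] by linarith
    then have "nr (X m - X n) < e" if "m \<ge> N" "n \<ge> N" for m n
      using \<open>e > 0\<close> that by (intro power2_less_imp_less[of _ e]) auto
    then show ?thesis by blast
  qed
  from complete[OF this] obtain p where p: "(\<lambda>n. nr (X n - p)) \<longlonglongrightarrow> 0" by blast
  \<comment> \<open>\<open>p + sc t m\<close> is the limit of the points \<open>X n + sc t m\<close>
    of \<open>M\<close>, so it is no nearer to \<open>x\<close> than \<open>d\<close>.\<close>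
  have le: "nr (x - p) \<le> nr ((x - p) - sc t m)" if m: "m \<in> M" for t m
  proof -
    have "nr (x - p) \<le> d"
    proof (rule LIMSEQ_le_const)
      show "(\<lambda>n. nr (x - X n) + nr (X n - p)) \<longlonglongrightarrow> d"
        using tendsto_add[OF limd p] by simp
      have "nr (x - p) \<le> nr (x - X n) + nr (X n - p)" for n
        using nr_triangle[of "x - X n" "X n - p"] by simp
      then show "\<exists>N. \<forall>n\<ge>N. nr (x - p) \<le> nr (x - X n) + nr (X n - p)" by blast
    qed
    also have "d \<le> nr ((x - p) - sc t m)"
    proof (rule LIMSEQ_le_const)
      show "(\<lambda>n. nr ((x - p) - sc t m) + nr (X n - p)) \<longlonglongrightarrow> nr ((x - p) - sc t m)"
        using tendsto_add[OF tendsto_const p] by simp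
      have "d \<le> nr ((x - p) - sc t m) + nr (X n - p)" for n
        using nr_triangle_diff[of "(x - p) - sc t m" "X n - p"]
          d_le[OF Madd[OF XM Msc[OF m m]], of n t] by (simp add: algebra_simps)
      then show "\<exists>N. \<forall>n\<ge>N. d \<le> nr ((x - p) - sc t m) + nr (X n - p)" by blast
    qed
    finally show ?thesis .
  qed
  show thesis
    using that[of X p] XM p orthogonal_if_nearest[OF le] by blast
qed

text \<open>The kernel of \<open>f\<close> is closed because \<open>f\<close> is bounded. A nonzero
  \<open>u\<close> orthogonal to it determines \<open>f\<close>, as
  \<open>x - sc (f x / f u) u\<close> lies in the kernel and hence is orthogonal to
  \<open>u\<close>.\<close>

lemma riesz:
  assumes add: "\<And>x y. f (x + y) = f x + f y" and scl: "\<And>a x. f (sc a x) = a * f x"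
    and bdd: "\<And>x. cmod (f x) \<le> C * nr x"
  shows "\<exists>z. \<forall>x. f x = ip x z"
proof (cases "\<forall>x. f x = 0")
  case True
  then show ?thesis by (intro exI[of _ 0]) simp
next
  case False
  then obtain x0 where x0: "f x0 \<noteq> 0" by blast
  have f0: "f 0 = 0" using scl[of 0 0] by simp
  have diff: "f (x - y) = f x - f y" for x y
    using add[of "x - y" y] by simp
  have "subspace_h sc {x. f x = 0}"
    by (simp add: subspace_h_def add scl f0)
  then obtain X p where X: "\<And>n. X n \<in> {x. f x = 0}" and lim: "(\<lambda>n. nr (X n - p)) \<longlonglongrightarrow> 0"
    and orth: "\<And>m. m \<in> {x. f x = 0} \<Longrightarrow> ip (x0 - p) m = 0"
    by (rule projection_closure[of "{x. f x = 0}" x0]) (rule that)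
  have "cmod (f p) \<le> C * nr (X n - p)" for n
    using bdd[of "p - X n"] X[of n] by (simp add: diff nr_minus_commute)
  then have "cmod (f p) \<le> 0"
    using tendsto_mult_right_zero[OF lim, of C] by (intro LIMSEQ_le_const) auto
  then have fu: "f (x0 - p) = f x0" by (simp add: diff)
  define u where "u = x0 - p"
  have fu0: "f u \<noteq> 0" using fu x0 by (simp add: u_def)
  then have u0: "u \<noteq> 0" using f0 by auto
  have "f x = ip x (sc (cnj (f u) / of_real ((nr u)\<^sup>2)) u)" for x
  proof -
    have "ip u (x - sc (f x / f u) u) = 0"
      unfolding u_def by (rule orth) (use fu0 in \<open>simp add: diff scl u_def[symmetric]\<close>)
    then have "ip (x - sc (f x / f u) u) u = 0"
      using ip_commute[of "x - sc (f x / f u) u" u] by (metis complex_cnj_zero_iff)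
    then have "ip x u = f x / f u * of_real ((nr u)\<^sup>2)"
      by (simp add: ip_linear ip_self)
    then show ?thesis
      using fu0 u0 by (simp add: ip_linear)
  qed
  then show ?thesis by blast
qed

section \<open>Adjoint and norm of a bounded operator\<close>

lemma adjoint_op:
  assumes "bounded_op sc ip T"
  shows "ip (T x) y = ip x (adjoint_op ip T y)"
proof -
  from assms obtain C where T: "\<And>x y. T (x + y) = T x + T y" "\<And>a x. T (sc a x) = sc a (T x)"
    and C: "\<And>x. nr (T x) \<le> C * nr x"
    unfolding bounded_op_def linear_on_h_def by auto
  have "cmod (ip (T x) y) \<le> (C * nr y) * nr x" for x
    using cauchy_schwarz[of "T x" y] mult_right_mono[OF C[of x], of "nr y"]
    by (simp add: mult_ac)
  then have "\<exists>z. \<forall>x. ip (T x) y = ip x z"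
    by (rule riesz[rotated -1]) (simp_all add: T ip_linear)
  then obtain z where z: "\<forall>x. ip (T x) y = ip x z" by blast
  have uniq: "z' = z" if "\<forall>x. ip (T x) y = ip x z'" for z'
  proof -
    have "ip (z' - z) (z' - z) = 0"
      unfolding ip_diff_right using z[rule_format, of "z' - z"] that[rule_format, of "z' - z"]
      by (metis right_minus_eq)
    then show ?thesis by (simp add: ip_self)
  qed
  show ?thesis
    unfolding adjoint_op_def
    by (rule theI[of "\<lambda>z. \<forall>x. ip (T x) y = ip x z", OF z uniq, rule_format])
qed

lemma opnorm_bound:
  assumes "bounded_op sc ip T"
  shows "nr (T x) \<le> opnorm ip T * nr x"
proof (cases "x = 0")
  case True
  have "T (sc 0 0) = sc 0 (T 0)"
    using assms unfolding bounded_op_def linear_on_h_def by blast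
  then show ?thesis using True by simp
next
  case False
  from assms obtain C where T: "\<And>a x. T (sc a x) = sc a (T x)"
    and C: "\<And>x. nr (T x) \<le> C * nr x"
    unfolding bounded_op_def linear_on_h_def by auto
  have "nr (T y) \<le> \<bar>C\<bar>" if "nr y \<le> 1" for y
  proof -
    have "nr (T y) \<le> \<bar>C\<bar> * nr y"
      using C[of y] mult_right_mono[OF abs_ge_self[of C] nr_nonneg[of y]] by linarith
    also have "\<dots> \<le> \<bar>C\<bar> * 1"
      using that by (intro mult_left_mono) auto
    finally show ?thesis by simp
  qed
  \<comment> \<open>A real supremum dominates its set only once the set is known to be bounded
    above; the estimate then follows from the normalized vector \<open>x / nr x\<close>.\<close>
  then have "bdd_above ((\<lambda>x. nr (T x)) ` {x. nr x \<le> 1})"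
    by (intro bdd_aboveI[of _ "\<bar>C\<bar>"]) auto
  then have "nr (T (sc (of_real (1 / nr x)) x)) \<le> opnorm ip T"
    unfolding opnorm_def by (rule cSUP_upper[rotated]) (simp add: nr_scale False norm_divide)
  then show ?thesis
    using nr_pos[OF False] by (simp add: T nr_scale norm_divide field_simps)
qed

end

section \<open>Self-adjoint operators: domain, real shifts, resolvent\<close>

locale self_adjoint_operator = complex_hilbert +
  fixes D :: "'a set" and T :: "'a \<Rightarrow> 'a"
  assumes self_adjoint: "self_adjoint_on sc ip D T"
begin

lemma T_linear: "linear_on_h sc D T"
  using self_adjoint unfolding self_adjoint_on_def by blast

lemma zero_in_D [simp]: "0 \<in> D"
  and add_in_D: "x \<in> D \<Longrightarrow> y \<in> D \<Longrightarrow> x + y \<in> D"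
  and scale_in_D: "x \<in> D \<Longrightarrow> sc a x \<in> D"
  using T_linear unfolding linear_on_h_def subspace_h_def by blast+

lemma T_add: "x \<in> D \<Longrightarrow> y \<in> D \<Longrightarrow> T (x + y) = T x + T y"
  and T_scale: "x \<in> D \<Longrightarrow> T (sc a x) = sc a (T x)"
  using T_linear unfolding linear_on_h_def by blast+

lemma T_symmetric: "x \<in> D \<Longrightarrow> y \<in> D \<Longrightarrow> ip (T x) y = ip x (T y)"
  using self_adjoint unfolding self_adjoint_on_def by blast

lemma D_dense: "e > 0 \<Longrightarrow> \<exists>y\<in>D. nr (x - y) < e"
  using self_adjoint unfolding self_adjoint_on_def dense_h_def by blast

lemma diff_in_D: "x \<in> D \<Longrightarrow> y \<in> D \<Longrightarrow> x - y \<in> D"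
  using add_in_D[of x "sc (- 1) y"] scale_in_D[of y "- 1"] by simp

lemma T_diff: "x \<in> D \<Longrightarrow> y \<in> D \<Longrightarrow> T (x - y) = T x - T y"
  using T_add[of x "sc (- 1) y"] scale_in_D[of y "- 1"] T_scale[of y "- 1"] by simp

lemma orthogonal_D_eq_0:
  assumes "\<And>x. x \<in> D \<Longrightarrow> ip x y = 0"
  shows "y = 0"
proof (rule ccontr)
  assume y: "y \<noteq> 0"
  then obtain x where x: "x \<in> D" "nr (y - x) < nr y"
    using D_dense[of "nr y" y] nr_pos by blast
  have "(nr y)\<^sup>2 = Re (ip (y - x) y)"
    by (simp add: nr_square ip_diff_left assms[OF x(1)])
  also have "\<dots> \<le> nr (y - x) * nr y"
    using complex_Re_le_cmod cauchy_schwarz order_trans by blast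
  also have "\<dots> < nr y * nr y"
    using x(2) nr_pos[OF y] by (intro mult_strict_right_mono)
  finally show False by (simp add: power2_eq_square)
qed

text \<open>This is \<open>T* = T\<close> in usable form: limits and orthogonality relations give an
  equation only weakly, tested against \<open>D\<close>, and this turns it into membership in
  \<open>D\<close> and a strong equation.\<close>

lemma adjoint_domain:
  assumes "\<And>x. x \<in> D \<Longrightarrow> ip (T x) u = ip x w"
  shows "u \<in> D" "T u = w"
proof -
  show u: "u \<in> D"
    using self_adjoint assms unfolding self_adjoint_on_def by blast
  have "ip x (T u - w) = 0" if "x \<in> D" for x
    using T_symmetric[OF that u] assms[OF that] by (simp add: ip_diff_right)
  then show "T u = w"
    using orthogonal_D_eq_0[of "T u - w"] by simp
qed

abbreviation shift :: "real \<Rightarrow> 'a \<Rightarrow> 'a" where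
  "shift t x \<equiv> T x - sc (of_real t) x"

lemma shift_add: "x \<in> D \<Longrightarrow> y \<in> D \<Longrightarrow> shift t (x + y) = shift t x + shift t y"
  by (simp add: T_add scale_right_distrib)

lemma shift_diff: "x \<in> D \<Longrightarrow> y \<in> D \<Longrightarrow> shift t (x - y) = shift t x - shift t y"
  by (simp add: T_diff scale_right_diff_distrib)

lemma shift_scale: "x \<in> D \<Longrightarrow> shift t (sc a x) = sc a (shift t x)"
  by (simp add: T_scale scale_right_diff_distrib mult.commute)

lemma shift_symmetric: "x \<in> D \<Longrightarrow> y \<in> D \<Longrightarrow> ip (shift t x) y = ip x (shift t y)"
  by (simp add: ip_linear T_symmetric)

lemma shift_shift: "shift s x = shift t x + sc (of_real (t - s)) x"
  by (simp add: scale_left_diff_distrib)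

lemma resolvent_inverse:
  assumes "z \<in> resolvent_set sc ip D T"
  obtains G C where "C \<ge> 0" "\<And>w. G w \<in> D" "\<And>w. T (G w) - sc z (G w) = w"
    "\<And>q. q \<in> D \<Longrightarrow> G (T q - sc z q) = q" "\<And>w. nr (G w) \<le> C * nr w"
proof -
  define S where "S = (\<lambda>x. T x - sc z x)"
  from assms obtain C where bij: "bij_betw S D UNIV" and C: "\<And>x. x \<in> D \<Longrightarrow> nr x \<le> C * nr (S x)"
    unfolding resolvent_set_def S_def by blast
  define G where "G = inv_into D S"
  have GD: "G w \<in> D" for w
    unfolding G_def using bij by (metis UNIV_I bij_betw_imp_surj_on inv_into_into)
  have SG: "S (G w) = w" for w
    unfolding G_def using bij by (metis UNIV_I bij_betw_imp_surj_on f_inv_into_f)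
  have GS: "G (S q) = q" if "q \<in> D" for q
    unfolding G_def using bij that by (metis bij_betw_imp_inj_on inv_into_f_f)
  have "nr (G w) \<le> \<bar>C\<bar> * nr w" for w
  proof -
    have "nr (G w) \<le> C * nr w" using C[OF GD[of w]] SG[of w] by simp
    then show ?thesis using mult_right_mono[OF abs_ge_self[of C] nr_nonneg[of w]] by linarith
  qed
  with GD SG GS show thesis
    by (intro that[of "\<bar>C\<bar>" G]) (auto simp: S_def)
qed

section \<open>Lower bounds for \<open>T - c\<close> from gaps in the spectrum\<close>

lemma gap_bound:
  assumes res: "\<And>t. \<bar>t - c\<bar> < r \<Longrightarrow> of_real t \<in> resolvent_set sc ip D T"
    and q: "q \<in> D"
  shows "r * nr q \<le> nr (shift c q)"
proof (rule ccontr)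
  assume contr: "\<not> ?thesis"
  then have q0: "q \<noteq> 0" using T_scale[of 0 0] by auto
  \<comment> \<open>All admissible constants; their supremum \<open>m\<close> is again admissible,
    and the rest of the proof improves it under the assumption \<open>m < r\<close>.\<close>
  define E where "E = {m. 0 \<le> m \<and> (\<forall>x\<in>D. m * nr x \<le> nr (shift c x))}"
  have upper: "m \<le> nr (shift c x) / nr x" if "m \<in> E" "x \<in> D" "x \<noteq> 0" for m x
    using that nr_pos[of x] by (auto simp: E_def field_simps)
  have bdd: "bdd_above E"
    using upper[OF _ q q0] by (rule bdd_aboveI)
  have zero: "0 \<in> E" by (simp add: E_def)
  define m where "m = Sup E"
  have mE: "m * nr x \<le> nr (shift c x)" if "x \<in> D" for x
  proof (cases "x = 0")
    case False
    have "m \<le> nr (shift c x) / nr x"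
      unfolding m_def using zero upper[OF _ that False] by (intro cSup_least) auto
    then show ?thesis using nr_pos[OF False] by (simp add: field_simps)
  qed simp
  have E_le: "m' \<le> m" if "m' \<in> E" for m'
    unfolding m_def using that bdd by (rule cSup_upper)
  have "m * nr q < r * nr q"
    using mE[OF q] contr by linarith
  then have mr: "m < r" using nr_pos[OF q0] by simp
  have m0: "m \<ge> 0" using E_le[OF zero] .
  have "of_real c \<in> resolvent_set sc ip D T" using m0 mr by (intro res) simp
  then obtain G C where G: "C \<ge> 0" "\<And>w. G w \<in> D" "\<And>w. shift c (G w) = w"
    "\<And>x. x \<in> D \<Longrightarrow> G (shift c x) = x" "\<And>w. nr (G w) \<le> C * nr w"
    by (rule resolvent_inverse) (rule that)
  have mpos: "m > 0"
  proof -
    \<comment> \<open>\<open>C\<close> is only known to be nonnegative, so \<open>C + 1\<close>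
      keeps the quotient positive. Strict positivity of \<open>m\<close> is what makes
      \<open>m' > m\<close> at the end.\<close>
    have "1 / (C + 1) \<in> E"
    proof -
      have "nr x \<le> nr (shift c x) * (C + 1)" if "x \<in> D" for x
        using G(5)[of "shift c x"] G(4)[OF that]
        by (simp add: algebra_simps add_increasing)
      then show ?thesis using G(1) by (auto simp: E_def pos_divide_le_eq)
    qed
    then have "1 / (C + 1) \<le> m" by (rule E_le)
    moreover have "1 / (C + 1) > 0" using G(1) by simp
    ultimately show ?thesis by linarith
  qed
  have "of_real (c + m) \<in> resolvent_set sc ip D T" using m0 mr by (intro res) simp
  then obtain G1 C1 where G1: "C1 \<ge> 0" "\<And>x. x \<in> D \<Longrightarrow> G1 (shift (c + m) x) = x" "\<And>w. nr (G1 w) \<le> C1 * nr w"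
    by (rule resolvent_inverse) (rule that)
  have "of_real (c - m) \<in> resolvent_set sc ip D T" using m0 mr by (intro res) simp
  then obtain G2 C2 where G2: "C2 \<ge> 0" "\<And>x. x \<in> D \<Longrightarrow> G2 (shift (c - m) x) = x" "\<And>w. nr (G2 w) \<le> C2 * nr w"
    by (rule resolvent_inverse) (rule that)
  \<comment> \<open>With \<open>G\<close> the inverse of \<open>T - c\<close>, this is
    \<open>(T - c - m) (T - c + m) G^2\<close>. Multiplying by \<open>G^2\<close> gives an operator
    on the whole space and avoids the domain of \<open>T^2\<close>. The two resolvents at
    \<open>c + m\<close> and \<open>c - m\<close> bound it from below.\<close>
  define W where "W w = w - sc (of_real (m\<^sup>2)) (G (G w))" for w
  have GG: "nr (G (G w)) \<le> C2 * C1 * nr (W w)" for w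
  proof -
    define u where "u = shift (c - m) (G (G w))"
    have u: "u = G w + sc (of_real m) (G (G w))"
      unfolding u_def shift_shift[of _ "c - m" c] G(3) by simp
    then have uD: "u \<in> D" using G(2) add_in_D scale_in_D by simp
    have "shift (c + m) u = w + sc (of_real m) (G w) - sc (of_real m) (G w + sc (of_real m) (G (G w)))"
      unfolding shift_shift[of _ "c + m" c] unfolding u shift_add[OF G(2) scale_in_D[OF G(2)]]
        shift_scale[OF G(2)] G(3) by simp
    also have "\<dots> = W w"
      by (simp add: W_def scale_right_distrib power2_eq_square)
    finally have W: "shift (c + m) u = W w" .
    have "nr (G (G w)) \<le> C2 * nr u"
      using G2(3)[of u] G2(2)[OF G(2)[of "G w"]] by (simp add: u_def)
    also have "\<dots> \<le> C2 * (C1 * nr (W w))"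
      using G1(3)[of "W w"] G1(2)[OF uD] G2(1) unfolding W by (intro mult_left_mono) simp_all
    finally show ?thesis by (simp add: mult.assoc)
  qed
  \<comment> \<open>The summand 2, where 1 would suffice for the bound \<open>WL\<close>, gives
    \<open>L > 1\<close>, so \<open>L^2 - 1\<close> can be divided by.\<close>
  define L where "L = 2 + m\<^sup>2 * (C2 * C1)"
  have L: "L > 1" using G1(1) G2(1) by (simp add: L_def add_pos_nonneg)
  have WL: "nr w \<le> L * nr (W w)" for w
  proof -
    have "nr w \<le> nr (W w) + m\<^sup>2 * nr (G (G w))"
      using nr_triangle[of "W w" "sc (of_real (m\<^sup>2)) (G (G w))"]
      by (simp add: W_def nr_scale norm_power)
    also have "\<dots> \<le> nr (W w) + m\<^sup>2 * (C2 * C1 * nr (W w))"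
      by (intro add_left_mono mult_left_mono GG) simp
    also have "\<dots> \<le> L * nr (W w)"
      using nr_nonneg[of "W w"] by (simp add: L_def algebra_simps)
    finally show ?thesis .
  qed
  have Wsq: "(nr (W w))\<^sup>2 \<le> (nr w)\<^sup>2 - m\<^sup>2 * (nr (G w))\<^sup>2" for w
  proof -
    have "ip w (G (G w)) = ip (G w) (G w)"
      using shift_symmetric[OF G(2)[of w] G(2)[of "G w"], of c] by (simp only: G(3))
    then have "(nr (W w))\<^sup>2 = (nr w)\<^sup>2 - 2 * m\<^sup>2 * (nr (G w))\<^sup>2 + m\<^sup>2 * (m * nr (G (G w)))\<^sup>2"
      unfolding W_def nr_diff_square
      by (simp add: ip_scale_right ip_self nr_scale power_mult_distrib norm_power norm_mult power2_eq_square mult_ac)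
    moreover have "m * nr (G (G w)) \<le> nr (G w)"
      using mE[OF G(2)[of "G w"]] by (simp only: G(3))
    then have "m\<^sup>2 * (m * nr (G (G w)))\<^sup>2 \<le> m\<^sup>2 * (nr (G w))\<^sup>2"
      using m0 by (intro mult_left_mono power_mono) auto
    ultimately show ?thesis by linarith
  qed
  \<comment> \<open>For \<open>w = shift c x\<close>, \<open>WL\<close> and \<open>Wsq\<close> give
    \<open>|w|^2 \<le> L^2 (|w|^2 - m^2 |x|^2)\<close>; solving for \<open>|w|\<close> yields this
    constant, which exceeds \<open>m\<close> because \<open>sqrt (L^2 - 1) < L\<close>.\<close>
  define m' where "m' = m * L / sqrt (L\<^sup>2 - 1)"
  have L2: "L\<^sup>2 - 1 > 0" using L by simp
  have "m' * nr x \<le> nr (shift c x)" if x: "x \<in> D" for x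
  proof -
    let ?w = "shift c x"
    have "(nr ?w)\<^sup>2 \<le> (L * nr (W ?w))\<^sup>2"
      by (intro power_mono WL) simp
    also have "\<dots> \<le> L\<^sup>2 * ((nr ?w)\<^sup>2 - m\<^sup>2 * (nr x)\<^sup>2)"
      using Wsq[of ?w] by (simp add: power_mult_distrib mult_left_mono G(4)[OF x])
    finally have "m\<^sup>2 * L\<^sup>2 * (nr x)\<^sup>2 \<le> (nr ?w)\<^sup>2 * (L\<^sup>2 - 1)"
      by (simp add: algebra_simps)
    then have "(m * L * nr x)\<^sup>2 \<le> (nr ?w * sqrt (L\<^sup>2 - 1))\<^sup>2"
      using L2 by (simp add: power_mult_distrib)
    then have "m * L * nr x \<le> nr ?w * sqrt (L\<^sup>2 - 1)"
      by (rule power2_le_imp_le) (use L2 in simp)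
    then show ?thesis using L2 by (simp add: m'_def divide_le_eq)
  qed
  moreover have "m' > m"
  proof -
    have "sqrt (L\<^sup>2 - 1) < sqrt (L\<^sup>2)" by (rule real_sqrt_less_mono) simp
    then have "sqrt (L\<^sup>2 - 1) < L" using L by simp
    then show ?thesis using mpos L2 by (simp add: m'_def less_divide_eq)
  qed
  ultimately have "m' \<in> E" using m0 by (simp add: E_def)
  from E_le[OF this] \<open>m' > m\<close> show False by simp
qed

text \<open>\<open>gap_bound\<close> squared and expanded around \<open>l\<close> in place of
  \<open>c\<close>. If \<open>l\<close> is an endpoint of the gap, the last coefficient vanishes,
  leaving the form of \<open>S (S + 2 (l - c))\<close> with \<open>S = T - l\<close>.\<close>

lemma quadratic_gap:
  assumes res: "\<And>t. \<bar>t - c\<bar> < r \<Longrightarrow> of_real t \<in> resolvent_set sc ip D T"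
    and q: "q \<in> D" and r: "r \<ge> 0"
  shows "0 \<le> (nr (shift l q))\<^sup>2 + 2 * (l - c) * Re (ip (shift l q) q) + ((l - c)\<^sup>2 - r\<^sup>2) * (nr q)\<^sup>2"
proof -
  have "(r * nr q)\<^sup>2 \<le> (nr (shift c q))\<^sup>2"
    using gap_bound[OF res q] r by (intro power_mono) auto
  also have "\<dots> = (nr (shift l q))\<^sup>2 + 2 * (l - c) * Re (ip (shift l q) q) + (l - c)\<^sup>2 * (nr q)\<^sup>2"
    unfolding shift_shift[of q c l] nr_add_square ip_scale_right nr_scale norm_of_real
      complex_cnj_complex_of_real
    by (simp add: power_mult_distrib)
  finally show ?thesis by (simp add: algebra_simps power_mult_distrib)
qed

text \<open>With S = T - l, A = S (S + g) and C = S (S - h), both A and C are nonnegative forms and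
  h A + g C = (g + h) S^2, so (g + h) A C S^2 = h A C A + g C A C. This is the positivity
  of the product of two commuting nonnegative operators, on the range of S^2.\<close>

lemma gap_bound_range_square:
  assumes res: "\<And>t. \<bar>t - c\<bar> < r \<Longrightarrow> t \<noteq> l \<Longrightarrow> of_real t \<in> resolvent_set sc ip D T"
    and l: "\<bar>l - c\<bar> < r"
    and x: "x \<in> D" and x1: "shift l x \<in> D" and x2: "shift l (shift l x) \<in> D"
  shows "r * nr (shift l (shift l x)) \<le> nr (shift c (shift l (shift l x)))"
proof -
  define g where "g = l - c + r"
  define h where "h = c + r - l"
  have gh: "g > 0" "h > 0" using l by (auto simp: g_def h_def)
  define y1 where "y1 = shift l x"
  define y2 where "y2 = shift l y1"
  define y3 where "y3 = shift l y2"
  have yD: "y1 \<in> D" "y2 \<in> D" using x1 x2 by (auto simp: y1_def y2_def)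
  \<comment> \<open>\<open>a, b, d, k, j\<close> are the moments \<open>ip (S^n x) x\<close> for n =
    6, 5, 4, 3, 2. They are split between both arguments because \<open>y3 = S^3 x\<close> need not
    lie in \<open>D\<close>.\<close>
  define a where "a = (nr y3)\<^sup>2"
  define b where "b = Re (ip y3 y2)"
  define d where "d = (nr y2)\<^sup>2"
  define k where "k = Re (ip y2 y1)"
  define j where "j = (nr y1)\<^sup>2"
  have y31: "ip y3 y1 = ip y2 y2"
    unfolding y3_def using shift_symmetric[OF yD(2) yD(1)] by (simp add: y2_def)
  have ips: "ip y3 y3 = of_real a" "ip y2 y2 = of_real d" "ip y3 y1 = of_real d"
    "ip y1 y1 = of_real j"
    by (simp_all add: a_def d_def j_def y31 ip_self)
  have Res: "Re (ip y3 y2) = b" "Re (ip y2 y3) = b" "Re (ip y2 y1) = k" "Re (ip y1 y2) = k"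
    using ip_commute[of y3 y2] ip_commute[of y2 y1] by (simp_all add: b_def k_def)
  \<comment> \<open>The gap here is from \<open>c - r\<close> to \<open>l\<close>, and for
    \<open>upper\<close> from \<open>l\<close> to \<open>c + r\<close>; each is centered at its
    midpoint with \<open>l\<close> as an endpoint, so no \<open>nr u\<close> term remains.\<close>
  have lower: "0 \<le> (nr (shift l u))\<^sup>2 + g * Re (ip (shift l u) u)" if "u \<in> D" for u
  proof -
    have "of_real t \<in> resolvent_set sc ip D T" if "\<bar>t - (l - g / 2)\<bar> < g / 2" for t
      using that l by (intro res) (auto simp: g_def abs_less_iff field_simps)
    from quadratic_gap[where c = "l - g / 2" and r = "g / 2" and q = u and l = l, OF this] gh \<open>u \<in> D\<close>
    show ?thesis by (simp add: power2_eq_square)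
  qed
  have upper: "0 \<le> (nr (shift l u))\<^sup>2 - h * Re (ip (shift l u) u)" if "u \<in> D" for u
  proof -
    have "of_real t \<in> resolvent_set sc ip D T" if "\<bar>t - (l + h / 2)\<bar> < h / 2" for t
      using that l by (intro res) (auto simp: h_def abs_less_iff field_simps)
    from quadratic_gap[where c = "l + h / 2" and r = "h / 2" and q = u and l = l, OF this] gh \<open>u \<in> D\<close>
    show ?thesis by (simp add: power2_eq_square)
  qed
  \<comment> \<open>\<open>u = A x\<close> and below \<open>v = C x\<close>. The form of
    \<open>C\<close> is then evaluated at \<open>u\<close> and that of \<open>A\<close> at
    \<open>v\<close>.\<close>
  define u where "u = y2 + sc (of_real g) y1"
  have u: "u \<in> D" "shift l u = y3 + sc (of_real g) y2"
    using yD by (simp_all only: u_def add_in_D scale_in_D shift_add shift_scale y2_def[symmetric] y3_def[symmetric])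
  define v where "v = y2 - sc (of_real h) y1"
  have v: "v \<in> D" "shift l v = y3 - sc (of_real h) y2"
    using yD by (simp_all only: v_def diff_in_D scale_in_D shift_diff shift_scale y2_def[symmetric] y3_def[symmetric])
  have norm_u: "(nr (shift l u))\<^sup>2 = a + 2 * g * b + g\<^sup>2 * d"
    unfolding u(2) nr_add_square ip_scale_right nr_scale
    by (simp add: power_mult_distrib a_def b_def d_def)
  have form_u: "Re (ip (shift l u) u) = b + 2 * g * d + g\<^sup>2 * k"
    unfolding u(2) unfolding u_def ip_linear by (simp add: ips Res algebra_simps power2_eq_square)
  have 1: "0 \<le> (a + 2 * g * b + g\<^sup>2 * d) - h * (b + 2 * g * d + g\<^sup>2 * k)"
    using upper[OF u(1)] unfolding norm_u form_u .
  have norm_v: "(nr (shift l v))\<^sup>2 = a - 2 * h * b + h\<^sup>2 * d"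
    unfolding v(2) nr_diff_square ip_scale_right nr_scale
    by (simp add: power_mult_distrib a_def b_def d_def)
  have form_v: "Re (ip (shift l v) v) = b - 2 * h * d + h\<^sup>2 * k"
    unfolding v(2) unfolding v_def ip_linear by (simp add: ips Res algebra_simps power2_eq_square)
  have 2: "0 \<le> (a - 2 * h * b + h\<^sup>2 * d) + g * (b - 2 * h * d + h\<^sup>2 * k)"
    using lower[OF v(1)] unfolding norm_v form_v .
  \<comment> \<open>The weights \<open>h\<close> and \<open>g\<close> cancel the \<open>k\<close>
    terms, and \<open>g + h\<close> factors out. What remains is the form of
    \<open>(S + g) (S - h) = (T - c)^2 - r^2\<close> at \<open>y2\<close>.\<close>
  have "0 \<le> h * ((a + 2 * g * b + g\<^sup>2 * d) - h * (b + 2 * g * d + g\<^sup>2 * k))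
      + g * ((a - 2 * h * b + h\<^sup>2 * d) + g * (b - 2 * h * d + h\<^sup>2 * k))"
    by (rule add_nonneg_nonneg[OF mult_nonneg_nonneg[OF _ 1] mult_nonneg_nonneg[OF _ 2]]) (use gh in auto)
  also have "\<dots> = (g + h) * (a + (g - h) * b - g * h * d)"
    by (simp add: algebra_simps power2_eq_square)
  finally have "0 \<le> a + (g - h) * b - g * h * d"
    using gh by (simp add: zero_le_mult_iff)
  moreover have "g - h = 2 * (l - c)" and "r\<^sup>2 = (l - c)\<^sup>2 + g * h"
    by (simp_all add: g_def h_def algebra_simps power2_eq_square)
  then have "(r * nr y2)\<^sup>2 = (l - c)\<^sup>2 * d + g * h * d" and "(g - h) * b = 2 * (l - c) * b"
    by (simp_all only: power_mult_distrib d_def distrib_right)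
  ultimately have "(r * nr y2)\<^sup>2 \<le> a + 2 * (l - c) * b + (l - c)\<^sup>2 * d"
    by linarith
  also have "\<dots> = (nr (shift c y2))\<^sup>2"
    unfolding shift_shift[of y2 c l] y3_def[symmetric] nr_add_square ip_scale_right nr_scale norm_of_real
      complex_cnj_complex_of_real
    by (simp add: power_mult_distrib a_def b_def d_def)
  finally show ?thesis
    unfolding y2_def y1_def by (rule power2_le_imp_le) simp
qed

text \<open>On the range of \<open>(T - l)^2\<close> the bound is known. Since the kernel of
  \<open>T - l\<close> is spanned by \<open>e\<close>, that range is dense, even in graph norm, in
  the part of \<open>D\<close> orthogonal to \<open>e\<close>, and the bound passes to the
  limit.\<close>

lemma gap_bound_orthogonal:
  assumes res: "\<And>t. \<bar>t - c\<bar> < r \<Longrightarrow> t \<noteq> l \<Longrightarrow> of_real t \<in> resolvent_set sc ip D T"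
    and e: "e \<in> D" "T e = sc (of_real l) e"
    and simple: "\<And>x. x \<in> D \<Longrightarrow> T x = sc (of_real l) x \<Longrightarrow> \<exists>a. x = sc a e"
    and q: "q \<in> D" "ip q e = 0"
  shows "r * nr q \<le> nr (shift c q)"
proof (cases "\<bar>l - c\<bar> < r")
  case False
  then have "of_real t \<in> resolvent_set sc ip D T" if "\<bar>t - c\<bar> < r" for t
    using res[OF that] that by auto
  from gap_bound[OF this q(1)] show ?thesis .
next
  case True
  \<comment> \<open>Half the distance from \<open>l\<close> to the right end of the interval, so
    \<open>l + \<mu>\<close> is a resolvent point.\<close>
  define \<mu> where "\<mu> = (c + r - l) / 2"
  have \<mu>: "\<mu> > 0" using True by (simp add: \<mu>_def abs_less_iff)
  have "of_real (l + \<mu>) \<in> resolvent_set sc ip D T"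
    using True \<mu> by (intro res) (auto simp: \<mu>_def abs_less_iff field_simps)
  then obtain G K where K: "K \<ge> 0" and GD: "\<And>w. G w \<in> D" and SG: "\<And>w. shift (l + \<mu>) (G w) = w"
    and GS: "\<And>x. x \<in> D \<Longrightarrow> G (shift (l + \<mu>) x) = x" and GK: "\<And>w. nr (G w) \<le> K * nr w"
    by (rule resolvent_inverse) (rule that)
  have G_add: "G (v + w) = G v + G w" for v w
    using GS[OF add_in_D[OF GD[of v] GD[of w]]] by (simp only: shift_add[OF GD GD] SG)
  have G_diff: "G (v - w) = G v - G w" for v w
    using GS[OF diff_in_D[OF GD[of v] GD[of w]]] by (simp only: shift_diff[OF GD GD] SG)
  have G_scale: "G (sc a w) = sc a (G w)" for a w
    using GS[OF scale_in_D[OF GD[of w]]] by (simp only: shift_scale[OF GD] SG)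
  \<comment> \<open>\<open>N = (T - l) G\<close> is a bounded symmetric stand-in for
    \<open>T - l\<close>: it commutes with \<open>G\<close>, and \<open>N y = 0\<close> makes
    \<open>G y\<close> a multiple of \<open>e\<close>.\<close>
  define N where "N w = w + sc (of_real \<mu>) (G w)" for w
  have SGN: "shift l (G w) = N w" for w
    unfolding shift_shift[of _ l "l + \<mu>"] SG N_def by simp
  have GN: "G (N w) = N (G w)" for w
    by (simp add: N_def G_add G_scale)
  have N_add: "N (v + w) = N v + N w" for v w
    by (simp add: N_def G_add scale_right_distrib algebra_simps)
  have N_scale: "N (sc a w) = sc a (N w)" for a w
    by (simp add: N_def G_scale scale_right_distrib mult.commute)
  have G_sym: "ip (G v) w = ip v (G w)" for v w
    using shift_symmetric[OF GD[of v] GD[of w], of "l + \<mu>"] by (simp only: SG)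
  have N_sym: "ip (N v) w = ip v (N w)" for v w
    by (simp add: N_def ip_linear G_sym)
  have Se: "shift l e = 0" using e by simp
  have Ne: "N e = 0"
  proof -
    have "shift (l + \<mu>) e = sc (of_real (- \<mu>)) e"
      unfolding shift_shift[of e "l + \<mu>" l] Se by simp
    then have "e = sc (of_real (- \<mu>)) (G e)"
      using GS[OF e(1)] G_scale by metis
    then show ?thesis
      unfolding N_def by (simp only: of_real_minus scale_minus_left eq_neg_iff_add_eq_0)
  qed
  define p where "p = shift (l + \<mu>) q"
  have "subspace_h sc (range (\<lambda>w. N (N w)))"
  proof -
    have "0 = N (N 0)" using N_scale[of 0 0] by simp
    then show ?thesis
      unfolding subspace_h_def by (auto simp: N_add[symmetric] N_scale[symmetric])
  qed
  then obtain p' X where X: "\<And>n. X n \<in> range (\<lambda>w. N (N w))" and lim: "(\<lambda>n. nr (X n - p')) \<longlonglongrightarrow> 0"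
    and orth: "\<And>m. m \<in> range (\<lambda>w. N (N w)) \<Longrightarrow> ip (p - p') m = 0"
    by (rule projection_closure[of _ p]) (rule that)
  \<comment> \<open>The defect \<open>p - p'\<close> is orthogonal to the range of
    \<open>N^2\<close>, so \<open>N\<close> kills it and it is a multiple of \<open>e\<close>. Both
    \<open>p\<close> and \<open>p'\<close> are orthogonal to \<open>e\<close>, so it is 0.\<close>
  have "p' = p"
  proof -
    define y where "y = p - p'"
    have "ip (N y) (N y) = 0"
      using orth[of "N (N y)"] by (simp add: y_def N_sym)
    then have Ny: "N y = 0" by (simp add: ip_self)
    then obtain a where "G y = sc a e"
      using simple[OF GD[of y]] SGN[of y] by auto
    then have y: "y = sc (- of_real \<mu> * a) e"
      using Ny by (simp add: N_def add_eq_0_iff)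
    have "ip e p = 0"
      unfolding p_def shift_shift[of q "l + \<mu>" l] using shift_symmetric[OF e(1) q(1), of l] q(2) ip_commute[of q e]
      by (simp add: ip_linear Se)
    moreover have "ip e p' = 0"
    proof -
      have "ip e (X n) = 0" for n
        using X[of n] N_scale[of 0 0] by (auto simp: N_sym[symmetric] Ne)
      then show ?thesis
        using tendsto_ip_right[OF lim, of e] by (simp add: LIMSEQ_const_iff)
    qed
    ultimately have "ip e y = 0" by (simp add: y_def ip_diff_right)
    then have "ip y y = 0" by (subst (1) y) (simp add: ip_linear)
    then show ?thesis by (simp add: ip_self y_def)
  qed
  have Gp: "G p = q" unfolding p_def by (rule GS[OF q(1)])
  have shift_G: "shift c (G w) = w + sc (of_real (l + \<mu> - c)) (G w)" for w
    unfolding shift_shift[of _ c "l + \<mu>"] SG by simp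
  have X_bound: "r * nr (G (X n)) \<le> nr (shift c (G (X n)))" for n
  proof -
    obtain w where w: "X n = N (N w)" using X[of n] by auto
    \<comment> \<open>\<open>G (N (N w)) = (T - l)^2 (G (G (G w)))\<close>, with all intermediate
      vectors in the range of \<open>G\<close> and hence in \<open>D\<close>.\<close>
    have eqs: "shift l (G (G (G w))) = G (G (N w))" "shift l (G (G (N w))) = G (X n)"
      unfolding w SGN by (simp_all only: GN)
    show ?thesis
      using gap_bound_range_square[OF res True, of "G (G (G w))"] GD unfolding eqs by blast
  qed
  \<comment> \<open>Collects the errors from replacing \<open>q = G p\<close> by
    \<open>G (X n)\<close>: \<open>r * K\<close> on the left side, and the norm bound of
    \<open>(T - c) G = 1 + (l + \<mu> - c) G\<close> on the right.\<close>
  define B where "B = 1 + \<bar>l + \<mu> - c\<bar> * K + r * K"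
  have r0: "r > 0" using True by linarith
  have le: "r * nr q \<le> nr (shift c q) + B * nr (X n - p')" for n
  proof -
    let ?y = "X n - p"
    have Gy: "G ?y = G (X n) - q" by (simp add: G_diff Gp)
    have "nr q \<le> nr (G (X n)) + nr (G ?y)"
      using nr_triangle_sub[of q "G (X n)"] by (simp add: Gy nr_minus_commute)
    also have "nr (G ?y) \<le> K * nr ?y" by (rule GK)
    finally have "r * nr q \<le> r * (nr (G (X n)) + K * nr ?y)"
      using r0 by (intro mult_left_mono) auto
    moreover have "nr (shift c (G (X n))) \<le> nr (shift c q) + nr (shift c (G ?y))"
      using nr_triangle_sub[of "shift c (G (X n))" "shift c q"]
      unfolding Gy shift_diff[OF GD q(1)] by simp
    moreover have "nr (shift c (G ?y)) \<le> nr ?y + \<bar>l + \<mu> - c\<bar> * (K * nr ?y)"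
    proof -
      have "nr (shift c (G ?y)) \<le> nr ?y + nr (sc (of_real (l + \<mu> - c)) (G ?y))"
        unfolding shift_G by (rule nr_triangle)
      also have "nr (sc (of_real (l + \<mu> - c)) (G ?y)) \<le> \<bar>l + \<mu> - c\<bar> * (K * nr ?y)"
        unfolding nr_scale norm_of_real by (intro mult_left_mono GK) simp
      finally show ?thesis by simp
    qed
    ultimately show ?thesis
      using X_bound[of n] \<open>p' = p\<close> by (simp add: B_def algebra_simps)
  qed
  show ?thesis
  proof (rule LIMSEQ_le_const)
    show "(\<lambda>n. nr (shift c q) + B * nr (X n - p')) \<longlonglongrightarrow> nr (shift c q)"
      using tendsto_add[OF tendsto_const tendsto_mult_right_zero[OF lim, of B]] by simp
    show "\<exists>N. \<forall>n\<ge>N. r * nr q \<le> nr (shift c q) + B * nr (X n - p')"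
      using le by blast
  qed
qed

text \<open>The form of \<open>T - Re z\<close> is real, so the imaginary part of \<open>z\<close>
  contributes no cross term to the squared norm.\<close>

lemma nr_shift_Re_le:
  assumes "q \<in> D"
  shows "nr (shift (Re z) q) \<le> nr (T q - sc z q)"
proof -
  have eq: "T q - sc z q = shift (Re z) q - sc (\<i> * of_real (Im z)) q"
    using complex_eq[of z] by (metis diff_diff_eq scale_left_distrib)
  have "cnj (ip (shift (Re z) q) q) = ip (shift (Re z) q) q"
    using shift_symmetric[OF assms assms, of "Re z"] ip_commute[of "shift (Re z) q" q] by metis
  then have "Im (ip (shift (Re z) q) q) = 0"
    by (metis Reals_cnj_iff complex_is_Real_iff)
  then have "(nr (shift (Re z) q))\<^sup>2 \<le> (nr (T q - sc z q))\<^sup>2"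
    unfolding eq nr_diff_square by (simp add: ip_scale_right)
  then show ?thesis by (rule power2_le_imp_le) simp
qed

end

section \<open>Bounded perturbations with \<open>J B = B* J\<close>\<close>

locale J_symmetric_perturbation = self_adjoint_operator +
  fixes J B :: "'a \<Rightarrow> 'a" and b :: real
  assumes J_add: "J (x + y) = J x + J y"
    and J_scale: "J (sc a x) = sc a (J x)"
    and J_unitary: "ip (J x) (J y) = ip x y"
    and J_invol [simp]: "J (J x) = x"
    and J_D: "x \<in> D \<Longrightarrow> J x \<in> D"
    and J_T: "x \<in> D \<Longrightarrow> J (T x) = T (J x)"
    and B_add: "B (x + y) = B x + B y"
    and B_scale: "B (sc a x) = sc a (B x)"
    and B_bound: "nr (B x) \<le> b * nr x"
    and b_nonneg: "b \<ge> 0"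
    and B_adjoint: "ip (B x) y = ip x (J (B (J y)))"
begin

abbreviation H :: "'a \<Rightarrow> 'a" where "H x \<equiv> T x + B x"

lemma J_symmetric: "ip (J x) y = ip x (J y)"
  using J_unitary[of x "J y"] by simp

lemma nr_J [simp]: "nr (J x) = nr x"
  by (simp add: hnorm_def J_unitary)

lemma B_diff: "B (x - y) = B x - B y"
  using B_add[of "x - y" y] by simp

lemma J_diff: "J (x - y) = J x - J y"
  using J_add[of "x - y" y] by simp

lemma H_diff: "x \<in> D \<Longrightarrow> y \<in> D \<Longrightarrow> H (x - y) = H x - H y"
  by (simp add: T_diff B_diff)

text \<open>The form ip (J u) v is indefinite, H is symmetric for it, and so an approximate
  eigenvector of H for a nonreal z is approximately J-neutral.\<close>

lemma J_neutral:
  assumes u: "u \<in> D"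
  shows "\<bar>Im z\<bar> * cmod (ip (J u) u) \<le> nr (H u - sc z u) * nr u"
proof -
  define y where "y = H u - sc z u"
  have "ip (J y) u = ip (J u) (T u) + ip (J u) (B u) - z * ip (J u) u"
    using T_symmetric[OF J_D[OF u] u] B_adjoint[of u "J u"]
    by (simp add: y_def J_add J_diff J_scale ip_linear J_T[OF u] J_symmetric)
  moreover have "ip (J u) y = ip (J u) (T u) + ip (J u) (B u) - cnj z * ip (J u) u"
    by (simp add: y_def ip_linear)
  ultimately have "ip (J u) y - ip (J y) u = (z - cnj z) * ip (J u) u"
    by (simp add: algebra_simps)
  then have "cmod (ip (J u) y - ip (J y) u) = 2 * \<bar>Im z\<bar> * cmod (ip (J u) u)"
    by (simp add: norm_mult complex_diff_cnj)
  moreover have "cmod (ip (J u) y - ip (J y) u) \<le> nr u * nr y + nr y * nr u"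
    using norm_triangle_ineq4[of "ip (J u) y" "ip (J y) u"]
      cauchy_schwarz[of "J u" y] cauchy_schwarz[of "J y" u] by (simp add: mult.commute[of "nr y"])
  ultimately show ?thesis unfolding y_def[symmetric] by (simp add: mult_ac)
qed

text \<open>\<open>\<alpha>\<close> and \<open>\<beta>\<close> are the squared norms of the
  components of \<open>u\<close> along \<open>e\<close> and orthogonal to it. \<open>T\<close> and
  \<open>J\<close> both respect this splitting, so no cross terms appear in the norm or in
  \<open>ip (J u) u\<close>.\<close>

lemma eigenvector_decomposition:
  assumes e: "e \<in> D" "e \<noteq> 0" "T e = sc (of_real l) e"
    and simple: "\<And>x. x \<in> D \<Longrightarrow> T x = sc (of_real l) x \<Longrightarrow> \<exists>a. x = sc a e"
    and res: "\<And>t. \<bar>t - Re z\<bar> < d \<Longrightarrow> t \<noteq> l \<Longrightarrow> of_real t \<in> resolvent_set sc ip D T"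
    and d: "d \<ge> 0"
    and u: "u \<in> D"
  obtains \<alpha> \<beta> where "(nr u)\<^sup>2 = \<alpha> + \<beta>"
    and "(l - Re z)\<^sup>2 * \<alpha> + d\<^sup>2 * \<beta> \<le> (nr (T u - sc z u))\<^sup>2"
    and "\<alpha> \<le> \<beta> + cmod (ip (J u) u)"
proof -
  define p where "p = sc (ip u e / of_real ((nr e)\<^sup>2)) e"
  define q where "q = u - p"
  have upq: "u = p + q" by (simp add: q_def)
  have pD: "p \<in> D" and qD: "q \<in> D"
    using e(1) u by (simp_all add: p_def q_def scale_in_D diff_in_D)
  have qe: "ip q e = 0"
    using e(2) by (simp add: q_def p_def ip_linear ip_self)
  have qp: "ip q p = 0" by (simp add: p_def ip_linear qe)
  then have pq: "ip p q = 0" using ip_commute[of q p] by simp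
  have Tp: "T p = sc (of_real l) p"
    by (simp add: p_def T_scale[OF e(1)] e(3) mult.commute)
  have 1: "(nr u)\<^sup>2 = (nr p)\<^sup>2 + (nr q)\<^sup>2"
    by (simp add: upq nr_add_square pq)
  have eq: "T u - sc z u = sc (of_real l - z) p + (T q - sc z q)"
    by (simp add: upq T_add[OF pD qD] Tp scale_right_distrib scale_left_diff_distrib)
  have orth: "ip p (T q - sc z q) = 0"
    using T_symmetric[OF pD qD] by (simp add: Tp ip_linear pq)
  have "d * nr q \<le> nr (shift (Re z) q)"
    by (rule gap_bound_orthogonal[OF res e(1) e(3) simple qD qe])
  also have "\<dots> \<le> nr (T q - sc z q)" by (rule nr_shift_Re_le[OF qD])
  finally have "(d * nr q)\<^sup>2 \<le> (nr (T q - sc z q))\<^sup>2"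
    using d by (intro power_mono) auto
  moreover have "(l - Re z)\<^sup>2 \<le> (cmod (of_real l - z))\<^sup>2"
    by (simp add: cmod_power2)
  then have "(l - Re z)\<^sup>2 * (nr p)\<^sup>2 \<le> (cmod (of_real l - z))\<^sup>2 * (nr p)\<^sup>2"
    by (intro mult_right_mono) auto
  ultimately have 2: "(l - Re z)\<^sup>2 * (nr p)\<^sup>2 + d\<^sup>2 * (nr q)\<^sup>2 \<le> (nr (T u - sc z u))\<^sup>2"
    unfolding eq nr_add_square ip_scale_left orth nr_scale by (simp add: power_mult_distrib)
  \<comment> \<open>\<open>J\<close> commutes with \<open>T\<close>, so simplicity makes
    \<open>J e\<close> a multiple \<open>s\<close> of \<open>e\<close>, and \<open>J^2 = 1\<close>
    forces \<open>s * s = 1\<close>. Thus the component along \<open>e\<close> contributes exactly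
    \<open>\<alpha>\<close> in modulus to \<open>ip (J u) u\<close>.\<close>
  have "T (J e) = sc (of_real l) (J e)"
    using J_T[OF e(1)] by (simp add: e(3) J_scale)
  then obtain s where s: "J e = sc s e" using simple[OF J_D[OF e(1)]] by blast
  have "sc (s * s) e = e"
    using J_invol[of e] by (simp add: s J_scale)
  then have "sc (s * s - 1) e = 0" by (simp add: scale_left_diff_distrib)
  then have "s * s = 1" using e(2) by simp
  then have cs: "cmod s = 1"
    by (metis norm_mult norm_one norm_ge_zero power2_eq_square power2_eq_1_iff neg_0_le_iff_le not_one_le_zero)
  have Jp: "J p = sc s p" by (simp add: p_def J_scale s mult.commute)
  have "ip (J q) p = 0" by (simp add: J_symmetric Jp ip_linear qp)
  then have eqJ: "ip (J u) u = s * of_real ((nr p)\<^sup>2) + ip (J q) q"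
    by (simp add: upq J_add ip_linear Jp pq ip_self)
  have "(nr p)\<^sup>2 = cmod (s * of_real ((nr p)\<^sup>2))"
    by (simp only: norm_mult cs norm_of_real abs_power2)
  also have "\<dots> = cmod (ip (J u) u - ip (J q) q)"
    unfolding eqJ by simp
  also have "\<dots> \<le> cmod (ip (J u) u) + cmod (ip (J q) q)"
    by (rule norm_triangle_ineq4)
  also have "cmod (ip (J q) q) \<le> (nr q)\<^sup>2"
    using cauchy_schwarz[of "J q" q] by (simp add: power2_eq_square)
  finally have 3: "(nr p)\<^sup>2 \<le> (nr q)\<^sup>2 + cmod (ip (J u) u)" by simp
  from that[OF 1 2 3] show thesis .
qed

text \<open>Approximate \<open>J\<close>-neutrality prevents \<open>u\<close> from concentrating on
  \<open>e\<close>, so \<open>T - z\<close> has at least the averaged squared bound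
  \<open>(A + d^2) / 2\<close> up to an error, and this average exceeds \<open>b^2\<close>.\<close>

lemma nonreal_lower_bound:
  assumes e: "e \<in> D" "e \<noteq> 0" "T e = sc (of_real l) e"
    and simple: "\<And>x. x \<in> D \<Longrightarrow> T x = sc (of_real l) x \<Longrightarrow> \<exists>a. x = sc a e"
    and res: "\<And>t. \<bar>t - Re z\<bar> < d \<Longrightarrow> t \<noteq> l \<Longrightarrow> of_real t \<in> resolvent_set sc ip D T"
    and d: "\<bar>l - Re z\<bar> \<le> d" and bd: "2 * b\<^sup>2 < (l - Re z)\<^sup>2 + d\<^sup>2"
    and z: "Im z \<noteq> 0"
  shows "\<exists>C\<ge>0. \<forall>u\<in>D. nr u \<le> C * nr (H u - sc z u)"
proof -
  define A where "A = (l - Re z)\<^sup>2"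
  define \<Delta> where "\<Delta> = (A + d\<^sup>2) / 2 - b\<^sup>2"
  define K where "K = 1 + 2 * b + (d\<^sup>2 - A) / (2 * \<bar>Im z\<bar>)"
  have \<Delta>: "\<Delta> > 0" using bd by (simp add: \<Delta>_def A_def)
  have Ad: "A \<le> d\<^sup>2" unfolding A_def using d by (metis abs_ge_zero power2_abs power_mono)
  have K: "K \<ge> 0" using b_nonneg Ad by (simp add: K_def)
  have "nr u \<le> (1 + K / \<Delta>) * nr (H u - sc z u)" if u: "u \<in> D" for u
  proof -
    define n where "n = nr u"
    define Y where "Y = nr (H u - sc z u)"
    define w where "w = cmod (ip (J u) u)"
    have n0: "n \<ge> 0" and Y0: "Y \<ge> 0" by (simp_all add: n_def Y_def)
    have "d \<ge> 0" using d by linarith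
    from eigenvector_decomposition[OF e simple res this u]
    obtain \<alpha> \<beta> where 1: "n\<^sup>2 = \<alpha> + \<beta>" and 2: "A * \<alpha> + d\<^sup>2 * \<beta> \<le> (nr (T u - sc z u))\<^sup>2"
      and 3: "\<alpha> \<le> \<beta> + w"
      unfolding A_def n_def w_def by blast
    have "nr (T u - sc z u) \<le> Y + b * n"
      using nr_triangle_diff[of "H u - sc z u" "B u"] B_bound[of u] by (simp add: Y_def n_def algebra_simps)
    then have "(nr (T u - sc z u))\<^sup>2 \<le> (Y + b * n)\<^sup>2"
      by (intro power_mono) auto
    with 2 have 4: "A * \<alpha> + d\<^sup>2 * \<beta> \<le> (Y + b * n)\<^sup>2" by linarith
    have "w \<le> Y * n / \<bar>Im z\<bar>"
      using J_neutral[OF u, of z] z by (simp add: w_def Y_def n_def field_simps)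
    then have "\<alpha> - \<beta> \<le> Y * n / \<bar>Im z\<bar>" using 3 by linarith
    then have "(d\<^sup>2 - A) / 2 * (\<alpha> - \<beta>) \<le> (d\<^sup>2 - A) / 2 * (Y * n / \<bar>Im z\<bar>)"
      using Ad by (intro mult_left_mono) auto
    \<comment> \<open>Mean plus deviation: \<open>d^2 - A\<close> is nonnegative by
      \<open>d\<close>, so the upper bound on \<open>\<alpha> - \<beta>\<close> controls the
      loss.\<close>
    moreover have "A * \<alpha> + d\<^sup>2 * \<beta> = (A + d\<^sup>2) / 2 * n\<^sup>2 - (d\<^sup>2 - A) / 2 * (\<alpha> - \<beta>)"
      unfolding 1 by (simp add: field_simps)
    ultimately have "(A + d\<^sup>2) / 2 * n\<^sup>2 \<le> (Y + b * n)\<^sup>2 + (d\<^sup>2 - A) / (2 * \<bar>Im z\<bar>) * (Y * n)"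
      using 4 by simp
    then have 5: "\<Delta> * n\<^sup>2 \<le> Y\<^sup>2 + 2 * b * (Y * n) + (d\<^sup>2 - A) / (2 * \<bar>Im z\<bar>) * (Y * n)"
      by (simp add: \<Delta>_def power2_sum algebra_simps power_mult_distrib)
    have "n \<le> (1 + K / \<Delta>) * Y"
    \<comment> \<open>For \<open>Y \<le> n\<close> the term \<open>Y^2\<close> is absorbed into
      \<open>Y * n\<close>, and a factor \<open>n\<close> cancels; otherwise the summand 1 of the
      constant is enough.\<close>
    proof (cases "Y \<le> n")
      case True
      have "Y\<^sup>2 \<le> Y * n" using True Y0 by (simp add: power2_eq_square mult_left_mono)
      with 5 have "\<Delta> * n\<^sup>2 \<le> K * (Y * n)" by (simp add: K_def algebra_simps)
      then have "n * (\<Delta> * n) \<le> n * (K * Y)" by (simp add: power2_eq_square mult_ac)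
      then have "\<Delta> * n \<le> K * Y \<or> n = 0" using n0 by (auto simp: mult_le_cancel_left)
      then have "n \<le> K / \<Delta> * Y"
        using \<Delta> K Y0 by (auto simp: field_simps)
      then show ?thesis using Y0 by (simp add: algebra_simps)
    next
      case False
      have "0 \<le> K / \<Delta> * Y" using \<Delta> K Y0 by simp
      with False show ?thesis by (simp add: algebra_simps)
    qed
    then show ?thesis by (simp add: n_def Y_def)
  qed
  moreover have "1 + K / \<Delta> \<ge> 0" using \<Delta> K by simp
  ultimately show ?thesis by blast
qed

text \<open>The range of H - z is closed by the first bound; its orthogonal complement is the kernel of
  J (H - cnj z) J, which is trivial by the second bound.\<close>

lemma resolvent_if_lower_bounds:
  assumes C: "C \<ge> 0" "\<And>u. u \<in> D \<Longrightarrow> nr u \<le> C * nr (H u - sc z u)"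
    and C': "\<And>u. u \<in> D \<Longrightarrow> nr u \<le> C' * nr (H u - sc (cnj z) u)"
  shows "z \<in> resolvent_set sc ip D H"
proof -
  define S where "S u = H u - sc z u" for u
  have S_diff: "S (u - v) = S u - S v" if "u \<in> D" "v \<in> D" for u v
    using H_diff[OF that] by (simp add: S_def scale_right_diff_distrib)
  have inj: "inj_on S D"
  proof (rule inj_onI)
    fix u v assume uv: "u \<in> D" "v \<in> D" "S u = S v"
    then have "nr (u - v) \<le> C * nr (S (u - v))"
      unfolding S_def using C(2) diff_in_D by blast
    then have "nr (u - v) \<le> 0" by (simp add: S_diff uv)
    then have "nr (u - v) = 0" using nr_nonneg[of "u - v"] by linarith
    then show "u = v" by simp
  qed
  have "\<exists>u\<in>D. S u = f" for f
  proof -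
    have "subspace_h sc (S ` D)"
    proof -
      have "0 = S (0 - 0)" using S_diff[of 0 0] by simp
      then have "0 \<in> S ` D" using zero_in_D by (metis diff_self image_eqI)
      moreover have "S u + S v = S (u + v)" "sc a (S u) = S (sc a u)" if "u \<in> D" "v \<in> D" for u v a
        using that by (simp_all add: S_def T_add B_add T_scale B_scale
            scale_right_distrib scale_right_diff_distrib mult.commute)
      ultimately show ?thesis
        unfolding subspace_h_def by (auto intro: add_in_D scale_in_D)
    qed
    then obtain p X where X: "\<And>n. X n \<in> S ` D" and lim: "(\<lambda>n. nr (X n - p)) \<longlonglongrightarrow> 0"
      and orth: "\<And>m. m \<in> S ` D \<Longrightarrow> ip (f - p) m = 0"
      by (rule projection_closure[of _ f]) (rule that)
    have "\<exists>u. u \<in> D \<and> X n = S u" for n using X[of n] by blast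
    then obtain U where U: "\<And>n. U n \<in> D" "\<And>n. X n = S (U n)"
      using choice[of "\<lambda>n u. u \<in> D \<and> X n = S u"] by blast
    have Cauchy: "nr (U m - U n) \<le> C * (nr (X m - p) + nr (X n - p))" for m n
    proof -
      have "nr (U m - U n) \<le> C * nr (X m - X n)"
        using C(2)[OF diff_in_D[OF U(1)[of m] U(1)[of n]]] unfolding S_def[symmetric]
        by (simp add: S_diff U)
      also have "nr (X m - X n) \<le> nr (X m - p) + nr (X n - p)"
        using nr_triangle_diff[of "X m - p" "X n - p"] by simp
      finally show ?thesis using C(1) by (simp add: mult_left_mono)
    qed
    have "\<exists>N. \<forall>m\<ge>N. \<forall>n\<ge>N. nr (U m - U n) < \<epsilon>" if "\<epsilon> > 0" for \<epsilon>
    proof -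
      have "(\<lambda>n. C * nr (X n - p)) \<longlonglongrightarrow> 0" using tendsto_mult_right_zero[OF lim] .
      then have "\<forall>\<^sub>F n in sequentially. C * nr (X n - p) < \<epsilon> / 2"
        by (rule order_tendstoD(2)) (use that in simp)
      then obtain N where "\<And>n. n \<ge> N \<Longrightarrow> C * nr (X n - p) < \<epsilon> / 2"
        by (auto simp: eventually_sequentially)
      then have "nr (U m - U n) < \<epsilon>" if "m \<ge> N" "n \<ge> N" for m n
        using Cauchy[of m n] that by (smt (verit) distrib_left field_sum_of_halves)
      then show ?thesis by blast
    qed
    from complete[OF this] obtain u where u: "(\<lambda>n. nr (U n - u)) \<longlonglongrightarrow> 0" by blast
    \<comment> \<open>Closedness of \<open>H\<close> on \<open>D\<close>: \<open>T (U n)\<close>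
      converges, and testing against \<open>x\<close> in \<open>D\<close> identifies
      \<open>u\<close> as a member of the adjoint's domain.\<close>
    have "ip (T x) u = ip x (p - B u + sc z u)" if x: "x \<in> D" for x
    proof (rule LIMSEQ_unique)
      show "(\<lambda>n. ip (T x) (U n)) \<longlonglongrightarrow> ip (T x) u"
        by (rule tendsto_ip_right[OF u])
      have TU: "T (U n) = X n - B (U n) + sc z (U n)" for n
        by (simp add: U(2) S_def)
      have BU: "(\<lambda>n. nr (B (U n) - B u)) \<longlonglongrightarrow> 0"
      proof (rule tendsto_sandwich[OF _ _ tendsto_const tendsto_mult_right_zero[OF u, of b]])
        show "\<forall>\<^sub>F n in sequentially. nr (B (U n) - B u) \<le> b * nr (U n - u)"
          using B_bound[of "U _ - u"] by (simp add: B_diff)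
      qed simp
      have "(\<lambda>n. ip x (X n) - ip x (B (U n)) + cnj z * ip x (U n))
          \<longlonglongrightarrow> ip x p - ip x (B u) + cnj z * ip x u"
        by (intro tendsto_intros tendsto_ip_right lim BU u)
      then show "(\<lambda>n. ip (T x) (U n)) \<longlonglongrightarrow> ip x (p - B u + sc z u)"
        unfolding T_symmetric[OF x U(1)] TU by (simp add: ip_linear)
    qed
    from adjoint_domain[OF this] have uD: "u \<in> D" and Su: "S u = p"
      by (simp_all add: S_def)
    define y where "y = f - p"
    have "ip (T x) y = ip x (sc (cnj z) y - J (B (J y)))" if x: "x \<in> D" for x
    proof -
      have "ip y (S x) = 0" using orth x by (simp add: y_def)
      then have "ip (S x) y = 0" using ip_commute[of "S x" y] by simp
      then show ?thesis
        by (simp add: S_def ip_linear B_adjoint algebra_simps)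
    qed
    from adjoint_domain[OF this] have yD: "y \<in> D" and Ty: "T y = sc (cnj z) y - J (B (J y))"
      by simp_all
    \<comment> \<open>Applying \<open>J\<close> to \<open>Ty\<close> cancels \<open>B (J y)\<close>,
      so \<open>J y\<close> solves the eigenvalue equation at \<open>cnj z\<close>, where the second
      bound excludes nonzero solutions.\<close>
    have "H (J y) = sc (cnj z) (J y)"
      using J_T[OF yD] by (simp add: Ty J_diff J_scale diff_eq_eq)
    then have "nr (J y) \<le> 0" using C'[OF J_D[OF yD]] by simp
    then have "nr y = 0" using nr_nonneg[of y] by simp
    then show ?thesis using uD Su by (auto simp: y_def)
  qed
  then have "S ` D = UNIV" by (metis UNIV_eq_I image_eqI)
  with inj C(2) show ?thesis
    unfolding resolvent_set_def bij_betw_def S_def by blast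
qed

end

section \<open>Choice of the eigenvalue and conclusion\<close>

theorem theorem1p2:
  fixes sc :: "complex \<Rightarrow> 'h::ab_group_add \<Rightarrow> 'h"
    and ip :: "'h \<Rightarrow> 'h \<Rightarrow> complex"
    and D :: "'h set"
    and H0 H1 J :: "'h \<Rightarrow> 'h"
    and lam :: "nat \<Rightarrow> real"
    and \<delta> :: real
  assumes hilb: "chilbert sc ip"
    and H0_sa: "self_adjoint_on sc ip D H0"
    and H0_below: "bounded_below_on ip D H0"
    and H1_bdd: "bounded_op sc ip H1"
    and H1_nz: "\<exists>x. H1 x \<noteq> 0"
    and J_lin: "linear_on_h sc UNIV J"
    and J_unitary: "surj J \<and> (\<forall>x y. ip (J x) (J y) = ip x y)"
    and J_invol: "\<forall>x. J (J x) = x"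
    and J_D: "J ` D \<subseteq> D"
    and J_H0: "\<forall>x\<in>D. J (H0 x) = H0 (J x)"
    and J_H1: "\<forall>x. J (H1 x) = adjoint_op ip H1 (J x)"
    and spec0: "spectrum_op sc ip D H0 = complex_of_real ` range lam"
    and lam_mono: "strict_mono lam"
    and simple: "\<forall>j. simple_eigenvalue sc D H0 (complex_of_real (lam j))"
    and delta_def: "\<delta> = (INF j. (lam (Suc j) - lam j) / 2)"
    and delta_pos: "\<delta> > 0"
  shows "\<forall>\<epsilon>::real. \<bar>\<epsilon>\<bar> < \<delta> / opnorm ip H1 \<longrightarrow>
           spectrum_op sc ip D (\<lambda>x. H0 x + sc (complex_of_real \<epsilon>) (H1 x)) \<subseteq> \<real>"
proof (intro allI impI subsetI)
  fix \<epsilon> :: real and z :: complex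
  assume \<epsilon>: "\<bar>\<epsilon>\<bar> < \<delta> / opnorm ip H1"
    and z: "z \<in> spectrum_op sc ip D (\<lambda>x. H0 x + sc (complex_of_real \<epsilon>) (H1 x))"
  interpret self_adjoint_operator sc ip D H0
    by unfold_locales (use hilb H0_sa in auto)
  have H1_add: "H1 (x + y) = H1 x + H1 y" and H1_scale: "H1 (sc a x) = sc a (H1 x)" for x y a
    using H1_bdd unfolding bounded_op_def linear_on_h_def by blast+
  have J_add: "J (x + y) = J x + J y" and J_scale: "J (sc a x) = sc a (J x)" for x y a
    using J_lin unfolding linear_on_h_def by blast+
  define b where "b = \<bar>\<epsilon>\<bar> * opnorm ip H1"
  \<comment> \<open>A nonzero \<open>H1\<close> has positive norm, so the quotient in the hypothesis
    on \<open>\<epsilon>\<close> is genuine and yields \<open>b < \<delta>\<close>.\<close>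
  obtain x1 where "H1 x1 \<noteq> 0" using H1_nz by blast
  then have "0 < opnorm ip H1 * nr x1"
    using nr_pos[of "H1 x1"] opnorm_bound[OF H1_bdd, of x1] by linarith
  then have opn: "opnorm ip H1 > 0"
    using nr_nonneg[of x1] by (simp add: zero_less_mult_iff)
  have b: "0 \<le> b" "b < \<delta>"
    using \<epsilon> opn by (simp_all add: b_def field_simps)
  interpret J_symmetric_perturbation sc ip D H0 J "\<lambda>x. sc (complex_of_real \<epsilon>) (H1 x)" b
  proof
    show "nr (sc (complex_of_real \<epsilon>) (H1 x)) \<le> b * nr x" for x
      using mult_left_mono[OF opnorm_bound[OF H1_bdd, of x] abs_ge_zero[of \<epsilon>]]
      by (simp add: nr_scale b_def mult.assoc)
    \<comment> \<open>The intertwining relation at \<open>J y\<close> gives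
      \<open>H1* = J H1 J\<close>; a real \<open>\<epsilon>\<close> is its own conjugate, so the
      scaled operator inherits this.\<close>
    have "adjoint_op ip H1 y = J (H1 (J y))" for y
      using J_H1[rule_format, of "J y"] J_invol by simp
    then show "ip (sc (complex_of_real \<epsilon>) (H1 x)) y = ip x (J (sc (complex_of_real \<epsilon>) (H1 (J y))))" for x y
      using adjoint_op[OF H1_bdd, of x y] by (simp add: J_scale ip_scale_left ip_scale_right)
  qed (use J_add J_scale J_unitary J_invol J_D J_H0 b H1_add H1_scale in
      \<open>auto simp: scale_right_distrib mult.commute\<close>)
  have gap: "2 * \<delta> \<le> lam k - lam j" if "j < k" for j k
  proof -
    have "bdd_below (range (\<lambda>j. (lam (Suc j) - lam j) / 2))"
      using lam_mono by (intro bdd_belowI[of _ 0]) (auto simp: strict_mono_less_eq)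
    then have "\<delta> \<le> (lam (Suc j) - lam j) / 2"
      unfolding delta_def by (rule cINF_lower) simp
    moreover have "lam (Suc j) \<le> lam k"
      using that lam_mono by (simp add: strict_mono_less_eq)
    ultimately show ?thesis by (simp add: field_simps)
  qed
  have gap': "2 * \<delta> \<le> \<bar>lam k - lam j\<bar>" if "k \<noteq> j" for j k
    using gap[of j k] gap[of k j] that by linarith
  define x where "x = Re z"
  obtain j where j: "\<And>k. \<bar>lam j - x\<bar> \<le> \<bar>lam k - x\<bar>"
  proof -
    \<comment> \<open>The eigenvalues grow at least linearly, so only finitely many are as close to
      \<open>x\<close> as \<open>lam 0\<close>; a nearest one exists among these.\<close>
    define A where "A = {k. \<bar>lam k - x\<bar> \<le> \<bar>lam 0 - x\<bar>}"
    have growth: "lam 0 + 2 * \<delta> * real k \<le> lam k" for k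
    proof (induction k)
      case (Suc k)
      then show ?case using gap[of k "Suc k"] by (simp add: algebra_simps)
    qed simp
    have "real k \<le> (x + \<bar>lam 0 - x\<bar> - lam 0) / (2 * \<delta>)" if "k \<in> A" for k
      using growth[of k] that delta_pos by (simp add: A_def field_simps)
    then have "A \<subseteq> {..nat \<lfloor>(x + \<bar>lam 0 - x\<bar> - lam 0) / (2 * \<delta>)\<rfloor>}"
      by (auto intro: le_nat_floor)
    then have fin: "finite A" by (rule finite_subset) simp
    define m where "m = Min ((\<lambda>k. \<bar>lam k - x\<bar>) ` A)"
    have A0: "0 \<in> A" by (simp add: A_def)
    then have "m \<in> (\<lambda>k. \<bar>lam k - x\<bar>) ` A"
      unfolding m_def using fin by (intro Min_in) auto
    then obtain i where i: "i \<in> A" "m = \<bar>lam i - x\<bar>" by blast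
    have "m \<le> \<bar>lam k - x\<bar>" if "k \<in> A" for k
      unfolding m_def using fin that by (intro Min_le) auto
    then have "\<bar>lam i - x\<bar> \<le> \<bar>lam k - x\<bar>" for k
      using i unfolding A_def by (metis linear mem_Collect_eq order_trans)
    then show thesis by (rule that)
  qed
  define a where "a = \<bar>lam j - x\<bar>"
  \<comment> \<open>Any other eigenvalue is at distance at least \<open>a\<close> by the choice of
    \<open>j\<close>, and at least \<open>2 * \<delta> - a\<close> by the gap and the triangle
    inequality.\<close>
  define d where "d = max a (2 * \<delta> - a)"
  have sep: "d \<le> \<bar>lam k - x\<bar>" if "k \<noteq> j" for k
    using gap'[OF that] j[of k] by (simp add: d_def a_def)
  have res: "complex_of_real t \<in> resolvent_set sc ip D H0" if "\<bar>t - x\<bar> < d" "t \<noteq> lam j" for t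
  proof (rule ccontr)
    assume "complex_of_real t \<notin> resolvent_set sc ip D H0"
    then have "complex_of_real t \<in> complex_of_real ` range lam"
      using spec0 unfolding spectrum_op_def by blast
    then obtain k where "t = lam k" by auto
    then show False using sep[of k] that by auto
  qed
  have bd: "2 * b\<^sup>2 < (lam j - x)\<^sup>2 + d\<^sup>2"
  proof -
    have "b\<^sup>2 < \<delta>\<^sup>2" using b by (intro power_strict_mono) auto
    \<comment> \<open>The difference of the two sides is
      \<open>2 * (a - \<delta>)^2\<close>.\<close>
    moreover have "2 * \<delta>\<^sup>2 \<le> a\<^sup>2 + (2 * \<delta> - a)\<^sup>2"
      using zero_le_power2[of "a - \<delta>"] by (simp add: power2_eq_square algebra_simps)
    moreover have "(2 * \<delta> - a)\<^sup>2 \<le> d\<^sup>2"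
      by (rule power2_le_iff_abs_le[THEN iffD2]) (use delta_pos in \<open>auto simp: d_def a_def\<close>)
    moreover have "(lam j - x)\<^sup>2 = a\<^sup>2" by (simp add: a_def)
    ultimately show ?thesis by linarith
  qed
  obtain e where e: "e \<noteq> 0"
    and eig: "eigenspace_op sc D H0 (complex_of_real (lam j)) = range (\<lambda>a. sc a e)"
    using simple unfolding simple_eigenvalue_def by blast
  have "sc 1 e \<in> eigenspace_op sc D H0 (complex_of_real (lam j))"
    unfolding eig by blast
  then have eD: "e \<in> D" and He: "H0 e = sc (complex_of_real (lam j)) e"
    by (simp_all add: eigenspace_op_def)
  have only: "\<exists>a. y = sc a e" if "y \<in> D" "H0 y = sc (complex_of_real (lam j)) y" for y
  proof -
    have "y \<in> eigenspace_op sc D H0 (complex_of_real (lam j))"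
      using that by (simp add: eigenspace_op_def)
    then show ?thesis unfolding eig by blast
  qed
  show "z \<in> \<real>"
  proof (rule ccontr)
    assume "z \<notin> \<real>"
    then have Im: "Im z \<noteq> 0" by (simp add: complex_is_Real_iff)
    \<comment> \<open>\<open>z\<close> and \<open>cnj z\<close> have the same real part, so one
      choice of \<open>e\<close> and \<open>d\<close> serves both lower bounds.\<close>
    have bound: "\<exists>C\<ge>0. \<forall>u\<in>D. nr u \<le> C * nr (H u - sc w u)" if "Re w = x" "Im w \<noteq> 0" for w
      by (rule nonreal_lower_bound[OF eD e He only, where d = d])
        (use that res bd in \<open>auto simp: d_def a_def\<close>)
    obtain C where "C \<ge> 0" "\<And>u. u \<in> D \<Longrightarrow> nr u \<le> C * nr (H u - sc z u)"
      using bound[of z] Im by (auto simp: x_def)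
    moreover obtain C' where "\<And>u. u \<in> D \<Longrightarrow> nr u \<le> C' * nr (H u - sc (cnj z) u)"
      using bound[of "cnj z"] Im by (auto simp: x_def)
    ultimately have "z \<in> resolvent_set sc ip D H"
      by (rule resolvent_if_lower_bounds)
    with z show False by (simp add: spectrum_op_def)
  qed
qed

end
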